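(* Let $\Gamma$ be the graph whose vertices are the elliptic ovoids of the symplectic subquadrangles of the Hermitian surface $\mathcal{H}(3,4)$ of $\mathrm{PG}(3,4)$, two vertices being adjacent whenever they meet in exactly one point and their symplectic subquadrangles meet in exactly six points. For a maximal clique $\{\mathcal{E},\mathcal{E}',\mathcal{E}''\}$ of $\Gamma$ (consisting of three vertices), let $\mathcal{W},\mathcal{W}',\mathcal{W}''$ denote the symplectic subquadrangles of $\mathcal{E},\mathcal{E}',\mathcal{E}''$, respectively. Then $\Gamma$ has exactly $1440$ maximal cliques such that $|\mathcal{W}\cap\mathcal{W}'\cap\mathcal{W}''|=6$ and exactly $4320$ maximal cliques such that $|\mathcal{W}\cap\mathcal{W}'\cap\mathcal{W}''|=2$.
   Context: A maximal clique is a set of pairwise adjacent vertices that is not properly contained in a larger set of pairwise adjacent vertices. Let $\perp$ be a non-degenerate unitary polarity of $\mathrm{PG}(3,4)$ and let $\mathcal{H}(3,4)$ be the Hermitian surface it defines, i.e. the incidence structure of the points and lines of $\mathrm{PG}(3,4)$ that are totally isotropic with respect to $\perp$ (it has $45$ points and $27$ lines, and is a generalized quadrangle of order $(4,2)$). Symplectic subquadrangles: let $\Sigma$ be a Baer subgeometry of $\mathrm{PG}(3,4)$, i.e. a subgeometry isomorphic to $\mathrm{PG}(3,2)$, and let $\mathcal{W}=\mathcal{W}(3,2)$ be the incidence structure of all points of $\Sigma$ (there are $15$) and of the $15$ lines of $\Sigma$ (called generators of $\mathcal{W}$) that are totally isotropic with respect to a non-degenerate symplectic polarity of $\Sigma$.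 This polarity extends uniquely to a symplectic polarity $\tilde{\perp}$ of $\mathrm{PG}(3,4)$. $\mathcal{W}$ is called a symplectic subquadrangle of $\mathcal{H}(3,4)$ if $\tilde{\perp}\perp=\perp\tilde{\perp}=\sigma$, where $\sigma$ is a semilinear involution whose set of fixed points is $\Sigma$ (so all points of $\Sigma$ lie on $\mathcal{H}(3,4)$ and $\perp$, $\tilde{\perp}$ induce the same polarity on $\Sigma$). Intersections of symplectic subquadrangles denote the sets of their common points; "meeting in $n$ points" means $|\mathcal{W}\cap\mathcal{W}'|=n$. Elliptic ovoids: an elliptic ovoid of $\mathcal{W}$ is an elliptic quadric $\mathcal{Q}^-(3,2)$ of $\Sigma$ (a set of $5$ points) such that the lines of $\Sigma$ tangent to it (meeting it in exactly one point) are precisely the $15$ generators of $\mathcal{W}$. An elliptic quadric of $\Sigma$ determines a unique symplectic quadrangle $\mathcal{W}$ of $\Sigma$ in this way, called the symplectic subquadrangle of the elliptic ovoid. *)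

theory Defs
  imports "HOL-Analysis.Analysis" "HOL-Library.Z2"
begin

text \<open>
  A projective space over a field \<open>'k\<close> is modelled by the lattice of subspaces of \<open>'k^'n\<close>; for
  \<open>PG(3,q)\<close> take \<open>'n = 4\<close> and \<open>CARD('k) = q\<close>.  Incidence is inclusion of subspaces.
\<close>

definition proj_points :: "('k::field ^ 'n) set set" where
  "proj_points = {P. vec.subspace P \<and> vec.dim P = 1}"

definition proj_lines :: "('k::field ^ 'n) set set" where
  "proj_lines = {l. vec.subspace l \<and> vec.dim l = 2}"


subsection \<open>Polarities\<close>

definition additive_form :: "('k::field ^ 'n \<Rightarrow> 'k ^ 'n \<Rightarrow> 'k) \<Rightarrow> bool" where
  "additive_form f \<longleftrightarrow>
     (\<forall>u v w. f (u + v) w = f u w + f v w) \<and> (\<forall>u v w. f u (v + w) = f u v + f u w)"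

definition bilinear_form :: "('k::field ^ 'n \<Rightarrow> 'k ^ 'n \<Rightarrow> 'k) \<Rightarrow> bool" where
  "bilinear_form f \<longleftrightarrow>
     additive_form f \<and> (\<forall>c u v. f (c *s u) v = c * f u v) \<and> (\<forall>c u v. f u (c *s v) = c * f u v)"

definition alternating_form :: "('k::field ^ 'n \<Rightarrow> 'k ^ 'n \<Rightarrow> 'k) \<Rightarrow> bool" where
  "alternating_form f \<longleftrightarrow> bilinear_form f \<and> (\<forall>v. f v v = 0)"

text \<open>
  Only meant for a field of four elements, whose involutory automorphism is \<open>x \<mapsto> x\<^sup>2\<close>.
\<close>
definition hermitian_form4 :: "('k::field ^ 'n \<Rightarrow> 'k ^ 'n \<Rightarrow> 'k) \<Rightarrow> bool" where
  "hermitian_form4 h \<longleftrightarrow>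
     additive_form h \<and> (\<forall>c u v. h (c *s u) v = c * h u v) \<and> (\<forall>u v. h v u = (h u v)\<^sup>2)"

definition nondegenerate_form :: "('k::field ^ 'n \<Rightarrow> 'k ^ 'n \<Rightarrow> 'k) \<Rightarrow> bool" where
  "nondegenerate_form f \<longleftrightarrow> (\<forall>u. (\<forall>v. f u v = 0) \<longrightarrow> u = 0)"

definition form_perp :: "('k::field ^ 'n \<Rightarrow> 'k ^ 'n \<Rightarrow> 'k) \<Rightarrow> ('k ^ 'n) set \<Rightarrow> ('k ^ 'n) set" where
  "form_perp f U = {v. \<forall>u\<in>U. f u v = 0}"

text \<open>A polarity is a map on subspaces; its values on other sets of vectors are irrelevant.\<close>

definition symplectic_polarity :: "(('k::field ^ 'n) set \<Rightarrow> ('k ^ 'n) set) \<Rightarrow> bool" where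
  "symplectic_polarity \<tau> \<longleftrightarrow>
     (\<exists>f. alternating_form f \<and> nondegenerate_form f \<and> (\<forall>U. vec.subspace U \<longrightarrow> \<tau> U = form_perp f U))"

definition unitary_polarity4 :: "(('k::field ^ 'n) set \<Rightarrow> ('k ^ 'n) set) \<Rightarrow> bool" where
  "unitary_polarity4 \<pi> \<longleftrightarrow>
     (\<exists>h. hermitian_form4 h \<and> nondegenerate_form h \<and> (\<forall>U. vec.subspace U \<longrightarrow> \<pi> U = form_perp h U))"

definition isotropic_points :: "(('k::field ^ 'n) set \<Rightarrow> ('k ^ 'n) set) \<Rightarrow> ('k ^ 'n) set set" where
  "isotropic_points \<pi> = {P \<in> proj_points. P \<subseteq> \<pi> P}"

definition isotropic_lines :: "(('k::field ^ 'n) set \<Rightarrow> ('k ^ 'n) set) \<Rightarrow> ('k ^ 'n) set set" where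
  "isotropic_lines \<pi> = {l \<in> proj_lines. l \<subseteq> \<pi> l}"

text \<open>
  An incidence structure is a pair (points, lines).  For a unitary polarity of \<open>PG(3,4)\<close> this is
  the Hermitian surface \<open>H(3,4)\<close>, for a symplectic polarity of \<open>PG(3,2)\<close> it is \<open>W(3,2)\<close>.
\<close>
definition isotropic_geometry ::
  "(('k::field ^ 'n) set \<Rightarrow> ('k ^ 'n) set) \<Rightarrow> ('k ^ 'n) set set \<times> ('k ^ 'n) set set" where
  "isotropic_geometry \<pi> = (isotropic_points \<pi>, isotropic_lines \<pi>)"


subsection \<open>Semilinear involutions\<close>

definition semilinear :: "('k::field ^ 'n \<Rightarrow> 'k ^ 'n) \<Rightarrow> bool" where
  "semilinear s \<longleftrightarrow>
     (\<exists>\<theta>. bij \<theta> \<and> (\<forall>a b. \<theta> (a + b) = \<theta> a + \<theta> b) \<and> (\<forall>a b. \<theta> (a * b) = \<theta> a * \<theta> b) \<and>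
          (\<forall>u v. s (u + v) = s u + s v) \<and> (\<forall>c v. s (c *s v) = \<theta> c *s s v))"

text \<open>The involution is the collineation \<open>U \<mapsto> s ` U\<close>, so \<open>s\<close> squares to a scalar map only.\<close>
definition semilinear_involution :: "('k::field ^ 'n \<Rightarrow> 'k ^ 'n) \<Rightarrow> bool" where
  "semilinear_involution s \<longleftrightarrow>
     semilinear s \<and> bij s \<and> (\<forall>P\<in>proj_points. s ` (s ` P) = P) \<and> (\<exists>P\<in>proj_points. s ` P \<noteq> P)"

definition fixed_points :: "('k::field ^ 'n \<Rightarrow> 'k ^ 'n) \<Rightarrow> ('k ^ 'n) set set" where
  "fixed_points s = {P \<in> proj_points. s ` P = P}"


subsection \<open>Baer subgeometries\<close>

text \<open>
  Meant for \<open>'k\<close> with four elements, where \<open>of_bit\<close> embeds \<open>GF(2)\<close> as the prime field.  For an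
  invertible matrix \<open>M\<close> the map \<open>baer_map M\<close> sends the subspaces of \<open>PG(3,2)\<close> to those subspaces of
  \<open>PG(3,4)\<close> that are spanned by vectors with coordinates in \<open>GF(2)\<close> with respect to the
  columns of \<open>M\<close>.
\<close>
definition baer_map :: "'k::field ^ 4 ^ 4 \<Rightarrow> (bit ^ 4) set \<Rightarrow> ('k ^ 4) set" where
  "baer_map M U = vec.span ((\<lambda>x. M *v (\<chi> i. of_bit (x $ i))) ` U)"

text \<open>A subspace \<open>U\<close> of the subgeometry \<open>\<Sigma>\<close> is represented by its extension to \<open>PG(3,4)\<close>.\<close>

definition baer_points :: "'k::field ^ 4 ^ 4 \<Rightarrow> ('k ^ 4) set set" where
  "baer_points M = baer_map M ` proj_points"

definition baer_lines :: "'k::field ^ 4 ^ 4 \<Rightarrow> ('k ^ 4) set set" where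
  "baer_lines M = baer_map M ` proj_lines"

text \<open>\<open>\<tau>\<close> is the extension to \<open>PG(3,4)\<close> of the polarity \<open>\<rho>\<close> of the subgeometry\<close>

definition extends_polarity ::
  "'k::field ^ 4 ^ 4 \<Rightarrow> ((bit ^ 4) set \<Rightarrow> (bit ^ 4) set) \<Rightarrow> (('k ^ 4) set \<Rightarrow> ('k ^ 4) set) \<Rightarrow> bool" where
  "extends_polarity M \<rho> \<tau> \<longleftrightarrow> (\<forall>U. vec.subspace U \<longrightarrow> \<tau> (baer_map M U) = baer_map M (\<rho> U))"


subsection \<open>Symplectic subquadrangles of the Hermitian surface\<close>

definition symplectic_subquadrangle ::
  "(('k::field ^ 4) set \<Rightarrow> ('k ^ 4) set) \<Rightarrow> ('k ^ 4) set set \<times> ('k ^ 4) set set \<Rightarrow> bool" where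
  "symplectic_subquadrangle \<pi> W \<longleftrightarrow>
     fst W \<subseteq> fst (isotropic_geometry \<pi>) \<and> snd W \<subseteq> snd (isotropic_geometry \<pi>) \<and>
     (\<exists>M \<rho> \<tau> s.
        invertible M \<and>
        symplectic_polarity \<rho> \<and> symplectic_polarity \<tau> \<and> extends_polarity M \<rho> \<tau> \<and>
        semilinear_involution s \<and> fixed_points s = baer_points M \<and>
        (\<forall>U. vec.subspace U \<longrightarrow> \<tau> (\<pi> U) = s ` U \<and> \<pi> (\<tau> U) = s ` U) \<and>
        W = (baer_points M, baer_map M ` isotropic_lines \<rho>))"


subsection \<open>Elliptic ovoids\<close>

definition quadratic_form :: "('k::field ^ 'n \<Rightarrow> 'k) \<Rightarrow> bool" where
  "quadratic_form Q \<longleftrightarrow>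
     (\<forall>c v. Q (c *s v) = c\<^sup>2 * Q v) \<and> bilinear_form (\<lambda>u v. Q (u + v) - Q u - Q v)"

text \<open>Non-degenerate means that the radical of the polar form contains no nonzero singular vector.\<close>
definition nondegenerate_quadratic_form :: "('k::field ^ 'n \<Rightarrow> 'k) \<Rightarrow> bool" where
  "nondegenerate_quadratic_form Q \<longleftrightarrow> quadratic_form Q \<and>
     (\<forall>u. Q u = 0 \<and> (\<forall>v. Q (u + v) - Q u - Q v = 0) \<longrightarrow> u = 0)"

definition quadric :: "('k::field ^ 'n \<Rightarrow> 'k) \<Rightarrow> ('k ^ 'n) set set" where
  "quadric Q = {P \<in> proj_points. \<forall>v\<in>P. Q v = 0}"

text \<open>Elliptic quadrics of \<open>PG(3,q)\<close>: Witt index one, i.e. the quadric has points but no lines.\<close>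
definition elliptic_quadric :: "('k::field ^ 4) set set \<Rightarrow> bool" where
  "elliptic_quadric E \<longleftrightarrow>
     (\<exists>Q. nondegenerate_quadratic_form Q \<and> E = quadric Q \<and> E \<noteq> {} \<and>
          \<not> (\<exists>l\<in>proj_lines. \<forall>v\<in>l. Q v = 0))"

text \<open>\<open>M\<close> is any frame of the subgeometry whose point set is that of \<open>W\<close>.\<close>
definition elliptic_ovoid ::
  "('k::field ^ 4) set set \<times> ('k ^ 4) set set \<Rightarrow> ('k ^ 4) set set \<Rightarrow> bool" where
  "elliptic_ovoid W E \<longleftrightarrow>
     (\<exists>M E\<^sub>0. invertible M \<and> fst W = baer_points M \<and>
            elliptic_quadric E\<^sub>0 \<and> E = baer_map M ` E\<^sub>0 \<and>
            snd W = {l \<in> baer_lines M. card {P \<in> E. P \<subseteq> l} = 1})"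

definition subquadrangle_of ::
  "(('k::field ^ 4) set \<Rightarrow> ('k ^ 4) set) \<Rightarrow> ('k ^ 4) set set \<Rightarrow> ('k ^ 4) set set \<times> ('k ^ 4) set set" where
  "subquadrangle_of \<pi> E = (THE W. symplectic_subquadrangle \<pi> W \<and> elliptic_ovoid W E)"


subsection \<open>The graph\<close>

definition ovoid_vertices ::
  "(('k::field ^ 4) set \<Rightarrow> ('k ^ 4) set) \<Rightarrow> ('k ^ 4) set set set" where
  "ovoid_vertices \<pi> = {E. \<exists>W. symplectic_subquadrangle \<pi> W \<and> elliptic_ovoid W E}"

definition ovoid_adjacent ::
  "(('k::field ^ 4) set \<Rightarrow> ('k ^ 4) set) \<Rightarrow> ('k ^ 4) set set \<Rightarrow> ('k ^ 4) set set \<Rightarrow> bool" where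
  "ovoid_adjacent \<pi> E E' \<longleftrightarrow>
     card (E \<inter> E') = 1 \<and> card (fst (subquadrangle_of \<pi> E) \<inter> fst (subquadrangle_of \<pi> E')) = 6"

definition clique :: "'v set \<Rightarrow> ('v \<Rightarrow> 'v \<Rightarrow> bool) \<Rightarrow> 'v set \<Rightarrow> bool" where
  "clique V adj C \<longleftrightarrow> C \<subseteq> V \<and> pairwise adj C"

definition maximal_clique :: "'v set \<Rightarrow> ('v \<Rightarrow> 'v \<Rightarrow> bool) \<Rightarrow> 'v set \<Rightarrow> bool" where
  "maximal_clique V adj C \<longleftrightarrow> clique V adj C \<and> \<not> (\<exists>D. clique V adj D \<and> C \<subset> D)"

text \<open>
  The maximal cliques on three vertices whose symplectic subquadrangles have exactly \<open>n\<close> common points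
\<close>
definition maximal_triangles ::
  "(('k::field ^ 4) set \<Rightarrow> ('k ^ 4) set) \<Rightarrow> nat \<Rightarrow> ('k ^ 4) set set set set" where
  "maximal_triangles \<pi> n =
     {{E, E', E''} | E E' E''.
        E \<noteq> E' \<and> E \<noteq> E'' \<and> E' \<noteq> E'' \<and>
        maximal_clique (ovoid_vertices \<pi>) (ovoid_adjacent \<pi>) {E, E', E''} \<and>
        card (fst (subquadrangle_of \<pi> E) \<inter> fst (subquadrangle_of \<pi> E') \<inter>
              fst (subquadrangle_of \<pi> E'')) = n}"

end

(*
  The ovoids are exactly the sets of five points spanned by a pentad, that is, by five vectors v with
  h u v = 0 if u = v and h u v = 1 otherwise.  Indeed h takes values in GF(2) on the GF(2)-space of a
  Baer subgeometry all of whose points are isotropic, and the condition on tangent lines forces it to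
  agree there with the polar form of the elliptic quadric, in which distinct singular points are never
  perpendicular.  The five vectors of a pentad sum to zero, and the subquadrangle consists of
  the points spanned by a vector of the pentad or by the sum of two of them.

  Four vectors of a pentad form a basis in which h has Gram matrix J - I, so all pentads look alike in
  their own coordinates.  A finite enumeration in these coordinates shows that there are 216 ovoids and
  that every ovoid lies on 20 + 60 triangles of the two kinds, and on no clique of four vertices;
  hence there are 216 * 20 / 3 and 216 * 60 / 3 maximal triangles.
*)
theory Submission
  imports Defs
begin

subsection \<open>Coordinates over the field of four elements\<close>

text \<open>\<open>F2\<close> and \<open>F3\<close> are the two primitive elements.\<close>
datatype f4 = F0 | F1 | F2 | F3

fun add4 :: "f4 \<Rightarrow> f4 \<Rightarrow> f4" where
  "add4 F0 b = b" | "add4 a F0 = a"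
| "add4 F1 F1 = F0" | "add4 F1 F2 = F3" | "add4 F1 F3 = F2"
| "add4 F2 F1 = F3" | "add4 F2 F2 = F0" | "add4 F2 F3 = F1"
| "add4 F3 F1 = F2" | "add4 F3 F2 = F1" | "add4 F3 F3 = F0"

fun mult4 :: "f4 \<Rightarrow> f4 \<Rightarrow> f4" where
  "mult4 F0 b = F0" | "mult4 F1 b = b"
| "mult4 F2 F0 = F0" | "mult4 F2 F1 = F2" | "mult4 F2 F2 = F3" | "mult4 F2 F3 = F1"
| "mult4 F3 F0 = F0" | "mult4 F3 F1 = F3" | "mult4 F3 F2 = F1" | "mult4 F3 F3 = F2"

fun conj4 :: "f4 \<Rightarrow> f4" where
  "conj4 F0 = F0" | "conj4 F1 = F1" | "conj4 F2 = F3" | "conj4 F3 = F2"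

datatype vec4 = Vec f4 f4 f4 f4

fun add_vec4 :: "vec4 \<Rightarrow> vec4 \<Rightarrow> vec4" where
  "add_vec4 (Vec a b c d) (Vec a' b' c' d') = Vec (add4 a a') (add4 b b') (add4 c c') (add4 d d')"

fun scale_vec4 :: "f4 \<Rightarrow> vec4 \<Rightarrow> vec4" where
  "scale_vec4 k (Vec a b c d) = Vec (mult4 k a) (mult4 k b) (mult4 k c) (mult4 k d)"

definition zero_vec4 :: vec4 where
  "zero_vec4 = Vec F0 F0 F0 F0"

text \<open>
  The Hermitian form with Gram matrix \<open>J - I\<close>, which is the outer product of the coordinate sums
  minus the standard form.
\<close>
fun herm4 :: "vec4 \<Rightarrow> vec4 \<Rightarrow> f4" where
  "herm4 (Vec a b c d) (Vec a' b' c' d') =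
    add4 (mult4 (add4 a (add4 b (add4 c d))) (conj4 (add4 a' (add4 b' (add4 c' d')))))
     (add4 (mult4 a (conj4 a')) (add4 (mult4 b (conj4 b'))
       (add4 (mult4 c (conj4 c')) (mult4 d (conj4 d')))))"

fun lead4 :: "vec4 \<Rightarrow> f4" where
  "lead4 (Vec a b c d) = (if a \<noteq> F0 then a else if b \<noteq> F0 then b else if c \<noteq> F0 then c else d)"

text \<open>In the field of four elements the inverse of a nonzero element is its conjugate.\<close>
definition normal4 :: "vec4 \<Rightarrow> vec4" where
  "normal4 x = scale_vec4 (conj4 (lead4 x)) x"

lemma add4_commute: "add4 a b = add4 b a"
  by (cases a; cases b) simp_all

lemma mult4_commute: "mult4 a b = mult4 b a"
  by (cases a; cases b) simp_all

lemma mult4_assoc: "mult4 (mult4 a b) c = mult4 a (mult4 b c)"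
  by (cases a; cases b; cases c) simp_all

lemma mult4_add_right: "mult4 a (add4 b c) = add4 (mult4 a b) (mult4 a c)"
  by (cases a; cases b; cases c) simp_all

lemma mult4_F1 [simp]: "mult4 a F1 = a" and mult4_F0 [simp]: "mult4 a F0 = F0"
  by (cases a; simp)+

lemma mult4_eq_F0_iff [simp]: "mult4 a b = F0 \<longleftrightarrow> a = F0 \<or> b = F0"
  by (cases a; cases b) simp_all

lemma conj4_eq_F0_iff [simp]: "conj4 a = F0 \<longleftrightarrow> a = F0"
  by (cases a) simp_all

lemma conj4_mult4_self: "a \<noteq> F0 \<Longrightarrow> mult4 (conj4 a) a = F1"
  by (cases a) simp_all

lemma conj4_conj4 [simp]: "conj4 (conj4 a) = a"
  by (cases a) simp_all

lemma conj4_add4: "conj4 (add4 a b) = add4 (conj4 a) (conj4 b)"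
  by (cases a; cases b) simp_all

lemma conj4_mult4: "conj4 (mult4 a b) = mult4 (conj4 a) (conj4 b)"
  by (cases a; cases b) simp_all

lemma scale_scale_vec4: "scale_vec4 j (scale_vec4 k x) = scale_vec4 (mult4 j k) x"
  by (cases x) (simp add: mult4_assoc)

lemma scale_vec4_F1 [simp]: "scale_vec4 F1 x = x"
  by (cases x) simp

lemma herm4_scale_left: "herm4 (scale_vec4 k x) y = mult4 k (herm4 x y)"
  by (cases x; cases y) (simp add: mult4_assoc mult4_add_right flip: mult4_add_right)

lemma herm4_commute: "herm4 y x = conj4 (herm4 x y)"
  by (cases x; cases y) (simp add: conj4_add4 conj4_mult4 mult4_commute)

lemma herm4_scale_right: "herm4 x (scale_vec4 k y) = mult4 (conj4 k) (herm4 x y)"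
  by (metis conj4_mult4 herm4_commute herm4_scale_left)

lemma herm4_zero [simp]: "herm4 zero_vec4 x = F0" "herm4 x zero_vec4 = F0"
  by (cases x; simp add: zero_vec4_def)+

lemma lead4_eq_F0_iff: "lead4 x = F0 \<longleftrightarrow> x = zero_vec4"
  by (cases x) (simp add: zero_vec4_def)

lemma lead4_scale: "lead4 (scale_vec4 k x) = mult4 k (lead4 x)"
  by (cases x; cases "k = F0") simp_all

lemma normal4_scale: "k \<noteq> F0 \<Longrightarrow> normal4 (scale_vec4 k x) = normal4 x"
  by (simp add: normal4_def lead4_scale scale_scale_vec4 conj4_mult4)
    (metis conj4_mult4_self mult4_F1 mult4_assoc mult4_commute)

lemma normal4_eqE:
  assumes "normal4 x = normal4 y" "x \<noteq> zero_vec4" "y \<noteq> zero_vec4"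
  obtains k where "k \<noteq> F0" "y = scale_vec4 k x"
proof
  have "y = scale_vec4 (lead4 y) (normal4 y)"
    using assms(3) by (simp add: normal4_def scale_scale_vec4 mult4_commute[of "lead4 y"]
        conj4_mult4_self lead4_eq_F0_iff)
  then show "y = scale_vec4 (mult4 (lead4 y) (conj4 (lead4 x))) x"
    by (simp add: assms(1)[symmetric]) (simp add: normal4_def scale_scale_vec4)
  show "mult4 (lead4 y) (conj4 (lead4 x)) \<noteq> F0"
    using assms by (simp add: lead4_eq_F0_iff)
qed

lemma normal4_normal4 [simp]: "normal4 (normal4 x) = normal4 x"
proof (cases "x = zero_vec4")
  case True
  then show ?thesis by (simp add: normal4_def zero_vec4_def)
next
  case False
  then show ?thesis
    using normal4_scale[of "conj4 (lead4 x)" x] by (simp add: normal4_def[of x] lead4_eq_F0_iff)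
qed

lemma normal4_eq_zero_iff [simp]: "normal4 x = zero_vec4 \<longleftrightarrow> x = zero_vec4"
  using lead4_eq_F0_iff[of x] lead4_eq_F0_iff[of "normal4 x"] by (simp add: normal4_def lead4_scale)

subsection \<open>Enumeration of cliques\<close>

fun cliques :: "('a \<Rightarrow> 'a \<Rightarrow> bool) \<Rightarrow> nat \<Rightarrow> 'a list \<Rightarrow> 'a list list" where
  "cliques R 0 xs = [[]]"
| "cliques R (Suc k) [] = []"
| "cliques R (Suc k) (x # xs) = map ((#) x) (cliques R k (filter (R x) xs)) @ cliques R (Suc k) xs"

lemma subseqs_filter: "subseqs (filter P xs) = filter (\<lambda>l. \<forall>x\<in>set l. P x) (subseqs xs)"
  by (induction xs) (auto simp: Let_def filter_map comp_def)

lemma filter_subseqs_Nil: "filter (\<lambda>l. l = []) (subseqs xs) = [[]]"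
  by (induction xs) (auto simp: Let_def filter_map comp_def)

lemma cliques_eq_filter_subseqs:
  "cliques R k xs = filter (\<lambda>l. length l = k \<and> sorted_wrt R l) (subseqs xs)"
proof (induction R k xs rule: cliques.induct)
  case (1 R xs)
  have "(\<lambda>l. length l = 0 \<and> sorted_wrt R l) = (\<lambda>l. l = [])"
    by auto
  then show ?case
    by (simp add: filter_subseqs_Nil)
next
  case (3 R k x xs)
  then show ?case
    by (auto simp: Let_def filter_map comp_def subseqs_filter intro!: filter_cong)
qed simp

lemma distinct_cliques: "distinct xs \<Longrightarrow> distinct (map set (cliques R k xs))"
  unfolding cliques_eq_filter_subseqs
  using distinct_map_filter distinct_set_subseqs by blast

lemma set_cliques:
  assumes "distinct xs" "symp R"
  shows "set ` set (cliques R k xs) = {S. S \<subseteq> set xs \<and> card S = k \<and> pairwise R S}"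
proof -
  have srt: "sorted_wrt R l \<longleftrightarrow> pairwise R (set l)" if "distinct l" for l
    using that assms(2) by (induction l) (auto simp: pairwise_insert dest: sympD)
  have "l \<in> set (cliques R k xs) \<longleftrightarrow>
      l \<in> set (subseqs xs) \<and> card (set l) = k \<and> pairwise R (set l)" for l
    using subseqs_distinctD[OF _ assms(1), of l] srt[of l]
    by (auto simp: cliques_eq_filter_subseqs distinct_card)
  then have "set ` set (cliques R k xs) =
      {S \<in> set ` set (subseqs xs). card S = k \<and> pairwise R S}"
    by (auto simp: image_iff)
  then show ?thesis
    by (auto simp: subseqs_powset)
qed

subsection \<open>Enumeration of pentads\<close>

definition pentad4 :: "vec4 set \<Rightarrow> bool" where
  "pentad4 S \<longleftrightarrow> card S = 5 \<and> (\<forall>u\<in>S. \<forall>v\<in>S. herm4 u v = (if u = v then F0 else F1))"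

definition points4 :: "vec4 list" where
  "points4 = (let fs = [F0,F1,F2,F3] in
     filter (\<lambda>x. x \<noteq> zero_vec4 \<and> herm4 x x = F0 \<and> normal4 x = x)
       [Vec a b c d. a \<leftarrow> fs, b \<leftarrow> fs, c \<leftarrow> fs, d \<leftarrow> fs])"

definition neighbours4 :: "vec4 \<Rightarrow> vec4 list \<Rightarrow> vec4 list" where
  "neighbours4 x ps = map (\<lambda>p. scale_vec4 (herm4 x p) p) (filter (\<lambda>p. herm4 x p \<noteq> F0) ps)"

fun pentads4 :: "vec4 list \<Rightarrow> vec4 list list" where
  "pentads4 [] = []"
| "pentads4 (x # xs) =
     map ((#) x) (cliques (\<lambda>u v. herm4 u v = F1) 4 (neighbours4 x xs)) @ pentads4 xs"

fun pair_sums4 :: "vec4 list \<Rightarrow> vec4 list" where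
  "pair_sums4 [] = []"
| "pair_sums4 (x # xs) = x # map (add_vec4 x) xs @ pair_sums4 xs"

lemma set_points4: "set points4 = {x. x \<noteq> zero_vec4 \<and> herm4 x x = F0 \<and> normal4 x = x}"
proof -
  define fs where "fs = [F0,F1,F2,F3]"
  have "y \<in> set fs" for y by (cases y) (simp_all add: fs_def)
  then have "set fs = UNIV" by blast
  then have "x \<in> set [Vec a b c d. a \<leftarrow> fs, b \<leftarrow> fs, c \<leftarrow> fs, d \<leftarrow> fs]" for x
    by (cases x) (simp add: image_iff)
  then show ?thesis by (auto simp: points4_def simp flip: fs_def)
qed

lemma distinct_points4: "distinct points4"
  by code_simp

lemma pentad4_scale:
  assumes "pentad4 S" "k \<noteq> F0"
  shows "pentad4 (scale_vec4 k ` S)"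
proof -
  have "inj (scale_vec4 k)"
    using assms(2) by (metis conj4_mult4_self injI scale_scale_vec4 scale_vec4_F1)
  then have "card (scale_vec4 k ` S) = card S"
    by (meson card_image inj_on_subset subset_UNIV)
  moreover have "mult4 k (mult4 (conj4 k) c) = c" for c
    using assms(2) by (metis conj4_conj4 conj4_eq_F0_iff conj4_mult4_self mult4.simps(2) mult4_assoc)
  ultimately show ?thesis
    using assms \<open>inj (scale_vec4 k)\<close>
    by (auto simp: pentad4_def herm4_scale_left herm4_scale_right inj_eq conj4_mult4_self)
qed

lemma normal4_image_scale: "k \<noteq> F0 \<Longrightarrow> normal4 ` scale_vec4 k ` S = normal4 ` S"
  by (simp add: image_image normal4_scale)

context
  fixes x :: vec4 and ps :: "vec4 list"
  assumes ps: "\<And>p. p \<in> set ps \<Longrightarrow> herm4 p p = F0 \<and> normal4 p = p"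
begin

lemma set_neighbours4:
  "set (neighbours4 x ps) = {u. normal4 u \<in> set ps \<and> herm4 x u = F1}"
proof (intro equalityI subsetI)
  fix u assume "u \<in> set (neighbours4 x ps)"
  then obtain p where p: "p \<in> set ps" "herm4 x p \<noteq> F0" "u = scale_vec4 (herm4 x p) p"
    by (auto simp: neighbours4_def)
  then show "u \<in> {u. normal4 u \<in> set ps \<and> herm4 x u = F1}"
    using ps[OF p(1)] by (simp add: normal4_scale herm4_scale_right conj4_mult4_self)
next
  fix u assume u: "u \<in> {u. normal4 u \<in> set ps \<and> herm4 x u = F1}"
  then have "u \<noteq> zero_vec4" by auto
  then obtain k where k: "k \<noteq> F0" "u = scale_vec4 k (normal4 u)"
    by (metis normal4_eqE normal4_eq_zero_iff normal4_normal4)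
  then have "mult4 (conj4 k) (herm4 x (normal4 u)) = F1"
    using u by (metis (mono_tags, lifting) herm4_scale_right mem_Collect_eq)
  then have "k = herm4 x (normal4 u)"
    by (cases k; cases "herm4 x (normal4 u)") simp_all
  with u k show "u \<in> set (neighbours4 x ps)"
    by (auto simp: neighbours4_def intro!: image_eqI[where x="normal4 u"])
qed

lemma distinct_neighbours4:
  assumes "distinct ps"
  shows "distinct (neighbours4 x ps)"
proof -
  have "inj_on (\<lambda>p. scale_vec4 (herm4 x p) p) (set (filter (\<lambda>p. herm4 x p \<noteq> F0) ps))"
    by (rule inj_onI) (auto, metis normal4_scale ps)
  with assms show ?thesis
    by (simp add: neighbours4_def distinct_map)
qed

lemma cliques_neighbours4:
  assumes "distinct ps"
  shows "set ` set (cliques (\<lambda>u v. herm4 u v = F1) 4 (neighbours4 x ps)) =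
    {S. S \<subseteq> {u. normal4 u \<in> set ps \<and> herm4 x u = F1} \<and> card S = 4 \<and>
        pairwise (\<lambda>u v. herm4 u v = F1) S}"
proof -
  have "symp (\<lambda>u v. herm4 u v = F1)"
    by (rule sympI) (metis conj4.simps(2) herm4_commute)
  then show ?thesis
    by (simp add: set_cliques assms distinct_neighbours4 set_neighbours4)
qed

end

lemma isotropic_normal4: "herm4 (normal4 u) (normal4 u) = F0 \<longleftrightarrow> u = zero_vec4 \<or> herm4 u u = F0"
  by (auto simp: normal4_def herm4_scale_left herm4_scale_right lead4_eq_F0_iff)

lemma pentads4_sound:
  assumes "\<And>p. p \<in> set ps \<Longrightarrow> p \<noteq> zero_vec4 \<and> herm4 p p = F0 \<and> normal4 p = p" "distinct ps"
    and "l \<in> set (pentads4 ps)"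
  shows "pentad4 (set l) \<and> distinct l"
  using assms
proof (induction ps)
  case (Cons x ps)
  show ?case
  proof (cases "l \<in> set (pentads4 ps)")
    case True
    with Cons show ?thesis by auto
  next
    case False
    then obtain m where m: "m \<in> set (cliques (\<lambda>u v. herm4 u v = F1) 4 (neighbours4 x ps))" "l = x # m"
      using Cons.prems by auto
    have "set m \<subseteq> {u. normal4 u \<in> set ps \<and> herm4 x u = F1} \<and> card (set m) = 4 \<and>
        pairwise (\<lambda>u v. herm4 u v = F1) (set m)"
      using cliques_neighbours4[of ps x] Cons.prems m(1) by auto
    moreover have "length m = 4"
      using m(1) by (simp add: cliques_eq_filter_subseqs)
    ultimately have m': "\<And>u. u \<in> set m \<Longrightarrow> normal4 u \<in> set ps \<and> herm4 x u = F1 \<and> herm4 u x = F1"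
      "card (set m) = 4" "distinct m" "pairwise (\<lambda>u v. herm4 u v = F1) (set m)"
      by (auto simp: card_distinct herm4_commute[of _ x])
    have iso: "herm4 u u = F0" if "u \<in> set m" for u
      using m'(1)[OF that] Cons.prems(1)[of "normal4 u"] isotropic_normal4[of u] by auto
    have x: "herm4 x x = F0"
      using Cons.prems(1) by simp
    then have "x \<notin> set m"
      using m'(1) by (metis f4.distinct(1))
    with m' iso x show ?thesis
      by (auto simp: m(2) pentad4_def pairwise_def)
  qed
qed simp

lemma pentads4_complete:
  assumes "\<And>p. p \<in> set ps \<Longrightarrow> p \<noteq> zero_vec4 \<and> herm4 p p = F0 \<and> normal4 p = p" "distinct ps"
    and "pentad4 S" "normal4 ` S \<subseteq> set ps"
  shows "\<exists>l\<in>set (pentads4 ps). normal4 ` set l = normal4 ` S"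
  using assms
proof (induction ps arbitrary: S)
  case Nil
  then show ?case by (auto simp: pentad4_def)
next
  case (Cons x ps)
  show ?case
  proof (cases "x \<in> normal4 ` S")
    case False
    then have "normal4 ` S \<subseteq> set ps"
      using Cons.prems(4) by auto
    then obtain l where "l \<in> set (pentads4 ps)" "normal4 ` set l = normal4 ` S"
      using Cons.IH[OF _ _ Cons.prems(3)] Cons.prems(1,2) by (auto simp del: herm4.simps)
    then show ?thesis
      by (metis UnCI pentads4.simps(2) set_append)
  next
    case True
    then obtain u where u: "u \<in> S" "x = normal4 u" by auto
    have x: "x \<noteq> zero_vec4" "herm4 x x = F0" "normal4 x = x"
      using Cons.prems(1) by auto
    then obtain k where k: "k \<noteq> F0" "x = scale_vec4 k u"
      using u normal4_eqE[of u x] by (metis normal4_eq_zero_iff)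
    define T where "T = scale_vec4 k ` S"
    have T: "pentad4 T" "normal4 ` T = normal4 ` S" "x \<in> T"
      using Cons.prems(3) k u by (auto simp: T_def pentad4_scale normal4_image_scale)
    have nx: "normal4 v \<noteq> x" if "v \<in> T - {x}" for v
    proof
      assume "normal4 v = x"
      then obtain c where "v = scale_vec4 c x"
        using x by (metis normal4_eqE normal4_eq_zero_iff)
      then have "herm4 x v = F0"
        by (simp add: herm4_scale_right x)
      with T that show False
        by (auto simp: pentad4_def)
    qed
    have "T - {x} \<subseteq> {u. normal4 u \<in> set ps \<and> herm4 x u = F1}"
      using T nx Cons.prems(4) by (fastforce simp: pentad4_def)
    moreover have "card (T - {x}) = 4"
      using T by (simp add: pentad4_def)
    moreover have "pairwise (\<lambda>u v. herm4 u v = F1) (T - {x})"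
      using T(1) by (auto simp: pairwise_def pentad4_def)
    ultimately have "T - {x} \<in> set ` set (cliques (\<lambda>u v. herm4 u v = F1) 4 (neighbours4 x ps))"
      using cliques_neighbours4[of ps x] Cons.prems(1,2) by auto
    then obtain m where m: "m \<in> set (cliques (\<lambda>u v. herm4 u v = F1) 4 (neighbours4 x ps))"
      "set m = T - {x}" by auto
    have "x # m \<in> set (pentads4 (x # ps))"
      using m(1) by simp
    moreover have "normal4 ` set (x # m) = normal4 ` S"
      using m(2) T(2,3) by (simp add: insert_absorb flip: image_insert)
    ultimately show ?thesis
      by (rule bexI[rotated])
  qed
qed

text \<open>
  An ovoid together with the point set of its subquadrangle, all points being given by normalised vectors.
\<close>
definition model_vertex :: "vec4 list \<Rightarrow> vec4 set \<times> vec4 set" where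
  "model_vertex l = (normal4 ` set l, normal4 ` set (pair_sums4 l))"

definition model_vertices :: "(vec4 set \<times> vec4 set) list" where
  "model_vertices = map model_vertex (pentads4 points4)"

definition model_adjacent :: "vec4 set \<times> vec4 set \<Rightarrow> vec4 set \<times> vec4 set \<Rightarrow> bool" where
  "model_adjacent a b \<longleftrightarrow> card (fst a \<inter> fst b) = 1 \<and> card (snd a \<inter> snd b) = 6"

definition base_pentad :: "vec4 list" where
  "base_pentad = [Vec F1 F0 F0 F0, Vec F0 F1 F0 F0, Vec F0 F0 F1 F0, Vec F0 F0 F0 F1, Vec F1 F1 F1 F1]"

definition base_neighbours :: "(vec4 set \<times> vec4 set) list" where
  "base_neighbours = filter (model_adjacent (model_vertex base_pentad)) model_vertices"

definition base_triangles :: "nat \<Rightarrow> (vec4 set \<times> vec4 set) list list" where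
  "base_triangles n = filter (\<lambda>t. card (fold (\<lambda>a. (\<inter>) (snd a)) t (snd (model_vertex base_pentad))) = n)
     (cliques model_adjacent 2 base_neighbours)"

lemma length_model_vertices: "length model_vertices = 216"
  by code_simp

lemma distinct_model_vertices: "distinct (map fst model_vertices)"
  by code_simp

lemma no_base_4_cliques: "cliques model_adjacent 3 base_neighbours = []"
  by code_simp

lemma length_base_triangles: "length (base_triangles 6) = 20 \<and> length (base_triangles 2) = 60"
  by code_simp

subsection \<open>Hermitian spaces of dimension four\<close>

lemma card_5_other:
  assumes "card S = 5"
  shows "\<exists>v\<in>S. v \<noteq> u"
proof (rule ccontr)
  assume "\<not> ?thesis"
  then have "S \<subseteq> {u}" by auto
  then have "card S \<le> card {u}"
    by (intro card_mono) auto
  with assms show False by simp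
qed

locale hermitian_space4 =
  fixes h :: "'k::{field,finite} ^ 4 \<Rightarrow> 'k ^ 4 \<Rightarrow> 'k"
  assumes card_field: "CARD('k) = 4"
    and hermitian: "hermitian_form4 h"
    and nondegenerate: "nondegenerate_form h"
begin

lemma h_add_left: "h (u + v) x = h u x + h v x"
  and h_add_right: "h x (u + v) = h x u + h x v"
  and h_scale_left: "h (k *s u) x = k * h u x"
  and h_commute: "h v u = (h u v)\<^sup>2"
  using hermitian unfolding hermitian_form4_def additive_form_def by blast+

lemma h_scale_right: "h u (k *s v) = k\<^sup>2 * h u v"
  by (metis h_commute h_scale_left power_mult_distrib)

lemma h_zero_left [simp]: "h 0 v = 0" and h_zero_right [simp]: "h v 0 = 0"
  using h_scale_left[of 0 0 v] h_scale_right[of v 0 0] by simp_all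

lemma form_value_surj: "\<exists>u v. h u v = k"
proof -
  obtain u v where uv: "h u v \<noteq> 0"
    using nondegenerate unfolding nondegenerate_form_def by (metis zero_neq_one axis_eq_0_iff)
  then have "h ((k / h u v) *s u) v = k"
    by (simp add: h_scale_left)
  then show ?thesis by blast
qed

lemma power4_eq: "k ^ 4 = (k::'k)"
proof -
  obtain u v where "h u v = k"
    using form_value_surj by blast
  then have "k = (k\<^sup>2)\<^sup>2"
    by (metis h_commute)
  then show ?thesis by simp
qed

lemma two_eq_zero [simp]: "2 = (0::'k)"
proof -
  obtain u v where uv: "h u v = 1"
    using form_value_surj by blast
  then have "h v u = 1"
    using h_commute[of v u] by simp
  then have "(1 + 1::'k) = (1 + 1)\<^sup>2"
    using h_commute[of v "u + u"] uv unfolding h_add_left h_add_right by (simp only:)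
  then have "(1 + 1::'k) = 0 \<or> (1 + 1::'k) = 1"
    by (metis mult_cancel_left1 power2_eq_square)
  then show ?thesis by (metis add_cancel_right_right one_add_one zero_neq_one)
qed

lemma add_self [simp]: "(k::'k) + k = 0" and add_self_left [simp]: "k + (k + j) = (j::'k)"
proof -
  show *: "k + k = 0"
    using two_eq_zero by (metis mult_2 mult_zero_left)
  show "k + (k + j) = j"
    by (simp add: * flip: add.assoc)
qed

lemma vec_add_self [simp]: "(v::'k^4) + v = 0" and vec_add_self_left [simp]: "v + (v + x) = (x::'k^4)"
  by (simp_all only: vec_eq_iff vector_add_component zero_index add_self add_self_left) simp_all

lemma add_eq_0_iff_eq: "(u::'k) + v = 0 \<longleftrightarrow> u = v"
  by (metis add_self add_left_cancel)

lemma vec_add_eq_0_iff: "(u::'k^4) + v = 0 \<longleftrightarrow> u = v"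
  by (simp add: vec_eq_iff add_eq_0_iff_eq)

lemma square_add: "((k::'k) + j)\<^sup>2 = k\<^sup>2 + j\<^sup>2"
  by (simp add: power2_sum)

lemma cube_eq: "k \<noteq> 0 \<Longrightarrow> k * k\<^sup>2 = (1::'k)"
  using power4_eq[of k] by (simp add: power4_eq_xxxx power2_eq_square mult.assoc)

lemma self_norm: "k = k\<^sup>2 \<longleftrightarrow> k = 0 \<or> k = (1::'k)"
  by (auto simp: power2_eq_square)

lemma self_form_cases: "h u u = 0 \<or> h u u = 1"
  using h_commute[of u u] self_norm by blast

definition w :: 'k where "w = (SOME x. x \<noteq> 0 \<and> x \<noteq> 1)"

lemma w_neq: "w \<noteq> 0" "w \<noteq> 1"
proof -
  have "\<exists>x::'k. x \<noteq> 0 \<and> x \<noteq> 1"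
  proof (rule ccontr)
    assume "\<not> ?thesis"
    then have "(UNIV::'k set) = {0, 1}" by auto
    then have "CARD('k) = card {0, 1::'k}" by simp
    with card_field show False by simp
  qed
  then have "w \<noteq> 0 \<and> w \<noteq> 1"
    unfolding w_def by (rule someI_ex)
  then show "w \<noteq> 0" "w \<noteq> 1" by auto
qed

lemma w_square: "w * w = w + 1"
proof -
  have "w * (w - 1) * (w * w + w + 1) = w ^ 4 - w"
    by (simp add: algebra_simps power4_eq_xxxx)
  then have "w * w + w + 1 = 0"
    using w_neq power4_eq[of w] by simp
  then show ?thesis
    by (simp add: add_eq_0_iff_eq add.assoc)
qed

lemma field_cases: "k = 0 \<or> k = 1 \<or> k = w \<or> k = w + 1"
proof -
  have "w + 1 \<noteq> 0" "w + 1 \<noteq> 1" "w + 1 \<noteq> w"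
    using w_neq by (auto simp: add_eq_0_iff_eq)
  then have "card {0, 1, w, w + 1} = CARD('k)"
    using w_neq by (simp add: card_field)
  then have "{0, 1, w, w + 1} = UNIV"
    by (simp add: card_eq_UNIV_imp_eq_UNIV)
  then show ?thesis by auto
qed

definition emb :: "f4 \<Rightarrow> 'k" where
  "emb k = (case k of F0 \<Rightarrow> 0 | F1 \<Rightarrow> 1 | F2 \<Rightarrow> w | F3 \<Rightarrow> w + 1)"

lemma emb_simps [simp]: "emb F0 = 0" "emb F1 = 1" "emb F2 = w" "emb F3 = w + 1"
  by (simp_all add: emb_def)

lemma emb_add: "emb (add4 j k) = emb j + emb k"
  by (cases j; cases k) (simp_all add: ac_simps)

lemma emb_mult: "emb (mult4 j k) = emb j * emb k"
  by (cases j; cases k) (simp_all add: w_square algebra_simps)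

lemma emb_conj: "emb (conj4 k) = (emb k)\<^sup>2"
  by (cases k) (simp_all add: power2_eq_square w_square algebra_simps)

lemma emb_eq_iff [simp]: "emb j = emb k \<longleftrightarrow> j = k"
  using w_neq by (cases j; cases k) (auto simp: add_eq_0_iff_eq)

lemma emb_eq_0_iff [simp]: "emb k = 0 \<longleftrightarrow> k = F0"
  using emb_eq_iff[of k F0] by (simp del: emb_eq_iff)

lemma emb_eq_1_iff [simp]: "emb k = 1 \<longleftrightarrow> k = F1"
  using emb_eq_iff[of k F1] by (simp del: emb_eq_iff)

lemma emb_surj: "\<exists>j. k = emb j"
  using field_cases[of k] by (metis emb_simps)

definition pentad :: "('k ^ 4) set \<Rightarrow> bool" where
  "pentad S \<longleftrightarrow> card S = 5 \<and> (\<forall>u\<in>S. \<forall>v\<in>S. h u v = of_bool (u \<noteq> v))"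

definition ovoid_of :: "('k ^ 4) set \<Rightarrow> ('k ^ 4) set set" where
  "ovoid_of S = (\<lambda>v. vec.span {v}) ` S"

definition quadrangle_points_of :: "('k ^ 4) set \<Rightarrow> ('k ^ 4) set set" where
  "quadrangle_points_of S = ovoid_of S \<union> {vec.span {u + v} | u v. u \<in> S \<and> v \<in> S \<and> u \<noteq> v}"

lemma span_singleton_scale:
  assumes "k \<noteq> (0::'k)"
  shows "vec.span {k *s (v::'k^4)} = vec.span {v}"
  using vec.span_image_scale[of "{v}" "\<lambda>_. k"] assms by simp

lemma span_singleton_eqE:
  assumes "vec.span {u} = vec.span {v::'k^4}" "v \<noteq> 0"
  obtains k where "k \<noteq> 0" "v = k *s u"
proof -
  have "v \<in> vec.span {u}"
    using assms(1) by (simp add: vec.span_base)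
  then obtain k where "v = k *s u"
    by (auto simp: vec.span_singleton)
  with assms(2) that show thesis by (metis vector_smult_lzero)
qed

text \<open>Gram--Schmidt: a form vanishing on the diagonal of the orthogonal complement would vanish
  there identically, since its values could be scaled to have trace one.\<close>
lemma extend_orthonormal:
  assumes "card B < 4" "\<forall>u\<in>B. \<forall>v\<in>B. h u v = of_bool (u = v)"
  shows "\<exists>y. y \<notin> B \<and> (\<forall>u\<in>insert y B. \<forall>v\<in>insert y B. h u v = of_bool (u = v))"
proof -
  define proj where "proj v = v + (\<Sum>e\<in>B. h v e *s e)" for v
  have h_sum: "h (sum f A) v = (\<Sum>e\<in>A. h (f e) v)"
    and h_sum_right: "h v (sum f A) = (\<Sum>e\<in>A. h v (f e))" for f v and A :: "('k ^ 4) set"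
    by (induction A rule: infinite_finite_induct) (simp_all add: h_add_left h_add_right)
  have h_proj: "h (proj v) e = 0" if "e \<in> B" for v e
  proof -
    have "(\<Sum>x\<in>B. h v x * h x e) = (\<Sum>x\<in>B. if x = e then h v e else 0)"
      using assms(2) that by (intro sum.cong) auto
    then show ?thesis
      using that by (simp add: proj_def h_add_left h_sum h_scale_left)
  qed
  have h_proj': "h e (proj v) = 0" if "e \<in> B" for v e
    using h_proj[OF that, of v] by (simp add: h_commute[of "proj v" e])
  have "\<exists>v. v \<notin> vec.span B"
  proof (rule ccontr)
    assume "\<not> ?thesis"
    then have "vec.span B = UNIV" by auto
    then have "vec.dim (UNIV :: ('k^4) set) \<le> card B"
      by (intro vec.dim_le_card) auto
    with assms(1) show False unfolding vec_dim_card by simp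
  qed
  then obtain v where v: "v \<notin> vec.span B" by blast
  define u where "u = proj v"
  have "u \<noteq> 0"
  proof
    assume "u = 0"
    then have "v = (\<Sum>e\<in>B. h v e *s e)"
      by (simp add: u_def proj_def vec_add_eq_0_iff)
    also have "\<dots> \<in> vec.span B"
      by (intro vec.span_sum vec.span_scale vec.span_base)
    finally show False using v by simp
  qed
  then obtain x where x: "h u x \<noteq> 0"
    using nondegenerate unfolding nondegenerate_form_def by blast
  define x' where "x' = proj x"
  have "h u x' = h u x"
    by (simp add: x'_def u_def proj_def[of x] h_add_right h_sum_right h_scale_right h_proj)
  then have x': "h u x' \<noteq> 0" using x by simp
  have "\<exists>y. h y y \<noteq> 0 \<and> (\<forall>e\<in>B. h y e = 0 \<and> h e y = 0)"
  proof (cases "h u u = 0 \<and> h x' x' = 0")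
    case False
    then show ?thesis
      using h_proj h_proj' by (auto simp: u_def x'_def)
  next
    case True
    define k where "k = (w / h u x')\<^sup>2"
    have k: "k\<^sup>2 * h u x' = w"
      using x' power4_eq[of "w / h u x'"] by (simp add: k_def)
    have "h x' u = (h u x')\<^sup>2"
      by (rule h_commute)
    then have "k * h x' u = (k\<^sup>2 * h u x')\<^sup>2"
      using power4_eq[of k] by (simp add: power_mult_distrib)
    then have "k * h x' u = w + 1"
      unfolding k by (simp add: power2_eq_square w_square)
    then have "h (u + k *s x') (u + k *s x') = 1"
      using True k by (simp add: h_add_left h_add_right h_scale_left h_scale_right add.commute)
    moreover have "h (u + k *s x') e = 0 \<and> h e (u + k *s x') = 0" if "e \<in> B" for e
      using h_proj h_proj' that
      by (simp add: u_def x'_def h_add_left h_add_right h_scale_left h_scale_right)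
    ultimately show ?thesis by (metis zero_neq_one)
  qed
  then obtain y where y: "h y y \<noteq> 0" "\<forall>e\<in>B. h y e = 0 \<and> h e y = 0" by blast
  have "h y y = 1"
    using y(1) self_form_cases by blast
  with y assms(2) show ?thesis
    by (intro exI[of _ y]) auto
qed

lemma ex_orthonormal: "n \<le> 4 \<Longrightarrow> \<exists>B. card B = n \<and> (\<forall>u\<in>B. \<forall>v\<in>B. h u v = of_bool (u = v))"
proof (induction n)
  case 0
  show ?case by (intro exI[of _ "{}"]) simp
next
  case (Suc n)
  then obtain B where B: "card B = n" "\<forall>u\<in>B. \<forall>v\<in>B. h u v = of_bool (u = v)" by auto
  then obtain y where "y \<notin> B" "\<forall>u\<in>insert y B. \<forall>v\<in>insert y B. h u v = of_bool (u = v)"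
    using extend_orthonormal[of B] Suc.prems by auto
  then show ?case
    using B(1) by (intro exI[of _ "insert y B"]) simp
qed

end

locale frame4 = hermitian_space4 h
  for h :: "'k::{field,finite} ^ 4 \<Rightarrow> 'k ^ 4 \<Rightarrow> 'k" +
  fixes a b c d :: "'k ^ 4"
  assumes isotropic: "h a a = 0" "h b b = 0" "h c c = 0" "h d d = 0"
    and pairs: "h a b = 1" "h a c = 1" "h a d = 1" "h b c = 1" "h b d = 1" "h c d = 1"
begin

lemma pairs': "h b a = 1" "h c a = 1" "h d a = 1" "h c b = 1" "h d b = 1" "h d c = 1"
  by (subst h_commute, simp add: pairs)+

lemmas frame_simps = isotropic pairs pairs' h_add_left h_add_right h_scale_left h_scale_right

fun comb :: "vec4 \<Rightarrow> 'k ^ 4" where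
  "comb (Vec x y z t) = emb x *s a + emb y *s b + emb z *s c + emb t *s d"

lemma comb_add: "comb (add_vec4 x y) = comb x + comb y"
  by (cases x; cases y) (simp add: emb_add vector_sadd_rdistrib ac_simps)

lemma comb_scale: "comb (scale_vec4 k x) = emb k *s comb x"
  by (cases x) (simp add: emb_mult vector_add_ldistrib)

lemma comb_zero [simp]: "comb zero_vec4 = 0"
  by (simp add: zero_vec4_def)

lemma h_comb: "h (comb x) (comb y) = emb (herm4 x y)"
  by (cases x; cases y)
    (simp add: frame_simps emb_add emb_mult emb_conj square_add algebra_simps)

lemma inj_comb: "inj comb"
proof
  fix x y assume eq: "comb x = comb y"
  obtain x1 x2 x3 x4 y1 y2 y3 y4 where xy: "x = Vec x1 x2 x3 x4" "y = Vec y1 y2 y3 y4"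
    by (metis vec4.exhaust)
  have "h (comb x) (b + c + d) = h (comb y) (b + c + d)"
       "h (comb x) (a + c + d) = h (comb y) (a + c + d)"
       "h (comb x) (a + b + d) = h (comb y) (a + b + d)"
       "h (comb x) (a + b + c) = h (comb y) (a + b + c)"
    using eq by simp_all
  then show "x = y"
    by (simp add: xy frame_simps ac_simps)
qed

lemma surj_comb: "\<exists>x. u = comb x"
proof -
  have eq: "(UNIV :: vec4 set) = (\<lambda>(a,b,c,d). Vec a b c d) ` UNIV"
    by (auto simp: image_iff) (metis vec4.exhaust)
  have "inj (\<lambda>(a,b,c,d). Vec a b c d)"
    by (auto intro: injI)
  then have "CARD(vec4) = CARD(f4 \<times> f4 \<times> f4 \<times> f4)"
    using eq by (metis card_image)
  moreover have "(UNIV :: f4 set) = {F0, F1, F2, F3}"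
    using f4.exhaust by auto
  then have "CARD(f4) = card {F0, F1, F2, F3}"
    by (rule arg_cong)
  ultimately have "CARD(vec4) = 256"
    by simp
  then have "card (range comb) = CARD('k ^ 4)"
    by (simp add: card_image inj_comb card_field)
  then show ?thesis
    by (metis card_eq_UNIV_imp_eq_UNIV finite UNIV_I image_iff)
qed

lemma comb_eq_0_iff [simp]: "comb x = 0 \<longleftrightarrow> x = zero_vec4"
  using inj_comb by (metis comb_zero injD)

lemma eq_zeroI:
  assumes "h u a = 0" "h u b = 0" "h u c = 0" "h u d = 0"
  shows "u = 0"
proof -
  have "h u v = 0" for v
  proof -
    obtain x where "v = comb x" using surj_comb by blast
    then show ?thesis
      by (cases x) (simp add: h_add_right h_scale_right assms)
  qed
  then show ?thesis
    using nondegenerate unfolding nondegenerate_form_def by blast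
qed

definition point :: "vec4 \<Rightarrow> ('k ^ 4) set" where
  "point x = vec.span {comb x}"

lemma point_normal4 [simp]: "point (normal4 x) = point x"
proof (cases "x = zero_vec4")
  case True
  then show ?thesis by (simp add: normal4_def zero_vec4_def)
next
  case False
  then show ?thesis
    by (simp add: point_def normal4_def comb_scale span_singleton_scale lead4_eq_F0_iff)
qed

lemma point_eq_imp_normal4:
  assumes "point x = point y" "y \<noteq> zero_vec4"
  shows "normal4 x = normal4 y"
proof -
  obtain k where k: "k \<noteq> 0" "comb y = k *s comb x"
    using assms span_singleton_eqE[of "comb x" "comb y"] by (auto simp: point_def)
  obtain j where "k = emb j" using emb_surj by blast
  with k have "comb y = comb (scale_vec4 j x)" "j \<noteq> F0"
    by (auto simp: comb_scale)
  then show ?thesis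
    using inj_comb by (metis injD normal4_scale)
qed

lemma inj_on_point: "inj_on point {x. x \<noteq> zero_vec4 \<and> normal4 x = x}"
  by (rule inj_onI) (metis (mono_tags, lifting) mem_Collect_eq point_eq_imp_normal4)

lemma pentad_comb_iff: "pentad (comb ` S) \<longleftrightarrow> pentad4 S"
proof -
  have "card (comb ` S) = card S"
    by (meson card_image inj_comb inj_on_subset subset_UNIV)
  then show ?thesis
    by (auto simp: pentad_def pentad4_def h_comb inj_eq[OF inj_comb] if_distrib)
qed

lemma pentad_imp_comb:
  assumes "pentad S"
  shows "\<exists>S'. pentad4 S' \<and> S = comb ` S'"
proof -
  have "S = comb ` (comb -` S)"
    using surj_comb by (metis surj_def surj_image_vimage_eq)
  then show ?thesis
    using assms pentad_comb_iff by metis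
qed

lemma set_pair_sums4:
  "distinct l \<Longrightarrow>
    set (pair_sums4 l) = set l \<union> {add_vec4 u v | u v. u \<in> set l \<and> v \<in> set l \<and> u \<noteq> v}"
proof (induction l)
  case (Cons x l)
  have "add_vec4 u v = add_vec4 v u" for u v
    by (cases u; cases v) (simp add: add4_commute)
  with Cons show ?case
    by auto
qed simp

lemma
  assumes "distinct l" "pentad4 (set l)"
  shows ovoid_of_comb: "ovoid_of (comb ` set l) = point ` fst (model_vertex l)"
    and quadrangle_points_of_comb:
      "quadrangle_points_of (comb ` set l) = point ` snd (model_vertex l)"
    and model_vertex_normal:
      "fst (model_vertex l) \<union> snd (model_vertex l) \<subseteq> {x. x \<noteq> zero_vec4 \<and> normal4 x = x}"
proof -
  show 1: "ovoid_of (comb ` set l) = point ` fst (model_vertex l)"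
    by (simp add: ovoid_of_def model_vertex_def image_image flip: point_def)
  have sums: "P \<in> {vec.span {u + v} | u v. u \<in> comb ` set l \<and> v \<in> comb ` set l \<and> u \<noteq> v} \<longleftrightarrow>
      (\<exists>x\<in>set l. \<exists>y\<in>set l. x \<noteq> y \<and> P = point (add_vec4 x y))" for P
    using inj_eq[OF inj_comb] unfolding point_def comb_add by blast
  have "{vec.span {u + v} | u v. u \<in> comb ` set l \<and> v \<in> comb ` set l \<and> u \<noteq> v} =
      point ` {add_vec4 x y | x y. x \<in> set l \<and> y \<in> set l \<and> x \<noteq> y}"
    by (intro set_eqI) (simp only: sums, auto)
  then have "quadrangle_points_of (comb ` set l) = point ` set (pair_sums4 l)"
    by (simp add: quadrangle_points_of_def ovoid_of_def set_pair_sums4[OF assms(1)] image_Un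
        image_image flip: point_def)
  then show "quadrangle_points_of (comb ` set l) = point ` snd (model_vertex l)"
    by (simp add: model_vertex_def image_image)
  have nz: "u \<noteq> zero_vec4" if u: "u \<in> set l" for u
  proof -
    obtain v where "v \<in> set l" "v \<noteq> u"
      using card_5_other[of "set l" u] assms(2) by (auto simp: pentad4_def)
    then have "herm4 u v = F1"
      using assms(2) u by (auto simp: pentad4_def)
    then show ?thesis by auto
  qed
  moreover have "add_vec4 u v \<noteq> zero_vec4" if "u \<noteq> v" for u v
    using that inj_comb by (metis comb_add comb_zero injD vec_add_eq_0_iff)
  ultimately show "fst (model_vertex l) \<union> snd (model_vertex l) \<subseteq> {x. x \<noteq> zero_vec4 \<and> normal4 x = x}"
    by (auto simp: model_vertex_def set_pair_sums4[OF assms(1)])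
qed

end

context hermitian_space4
begin

lemma ex_frame: "\<exists>a b c d. frame4 h a b c d"
proof -
  obtain B where B: "card B = 4" "\<forall>u\<in>B. \<forall>v\<in>B. h u v = of_bool (u = v)"
    using ex_orthonormal[of 4] by auto
  obtain l where l: "set l = B" "distinct l"
    using finite_distinct_list[of B] by auto
  then have "length l = 4"
    using B(1) by (simp flip: distinct_card)
  then obtain p q r s where "l = [p, q, r, s]"
    by (auto simp: length_Suc_conv numeral_eq_Suc)
  with l have pqrs: "B = {p, q, r, s}" "distinct [p, q, r, s]"
    by auto
  have "h u v = (if u = v then 1 else 0)" if "u \<in> B" "v \<in> B" for u v
    using B(2) that by simp
  then have e: "h p p = 1" "h p q = 0" "h p r = 0" "h p s = 0" "h q p = 0" "h q q = 1" "h q r = 0"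
    "h q s = 0" "h r p = 0" "h r q = 0" "h r r = 1" "h r s = 0" "h s p = 0" "h s q = 0" "h s r = 0"
    "h s s = 1"
    using pqrs by auto
  have "frame4 h (p + q) (p + r) (p + s) (w *s p + (w + 1) *s (q + r + s))"
    by unfold_locales
      (simp_all add: e h_add_left h_add_right h_scale_left h_scale_right power2_eq_square w_square algebra_simps)
  then show ?thesis by blast
qed

lemma pentad_frame:
  assumes "pentad S"
  obtains a b c d where "frame4 h a b c d" "S = {a, b, c, d, a + b + c + d}"
    "distinct [a, b, c, d, a + b + c + d]"
proof -
  obtain l where l: "set l = S" "distinct l"
    using finite_distinct_list[of S] by auto
  then have "length l = 5"
    using assms by (simp add: pentad_def flip: distinct_card)
  then obtain a b c d e where abcde: "l = [a, b, c, d, e]"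
    by (auto simp: length_Suc_conv numeral_eq_Suc)
  have *: "h u v = (if u = v then 0 else 1)" if "u \<in> set l" "v \<in> set l" for u v
    using assms that by (simp add: pentad_def l(1))
  interpret frame4 h a b c d
    by unfold_locales (use * l(2) in \<open>auto simp: abcde\<close>)
  have "h (e + a + b + c + d) x = 0" if "x \<in> {a, b, c, d}" for x
    using that * l(2) by (auto simp: abcde frame_simps)
  then have "e + a + b + c + d = 0"
    by (intro eq_zeroI) auto
  then have "e + (a + b + c + d) = 0"
    by (simp add: ac_simps)
  then have "e = a + b + c + d"
    by (simp only: vec_add_eq_0_iff)
  with that frame4_axioms l abcde show thesis by auto
qed

lemma ovoid_of_eqE:
  assumes "pentad S" "pentad T" "ovoid_of S = ovoid_of T"
  obtains k where "k \<noteq> 0" "T = (\<lambda>v. k *s v) ` S"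
proof -
  have nz: "v \<noteq> 0" if v: "v \<in> S" "pentad S" for v S
  proof -
    obtain u where "u \<in> S" "u \<noteq> v"
      using card_5_other[of S v] v(2) by (auto simp: pentad_def)
    then have "h v u = 1"
      using v by (auto simp: pentad_def)
    then show ?thesis by auto
  qed
  have "\<exists>k. k \<noteq> 0 \<and> k *s v \<in> T" if "v \<in> S" for v
  proof -
    have "vec.span {v} \<in> ovoid_of T"
      using assms(3) that by (auto simp: ovoid_of_def)
    then obtain t where "t \<in> T" "vec.span {v} = vec.span {t}"
      by (auto simp: ovoid_of_def)
    then show ?thesis
      using span_singleton_eqE[of v t] nz[OF _ assms(2)] by metis
  qed
  then obtain f where f: "\<And>v. v \<in> S \<Longrightarrow> f v \<noteq> 0 \<and> f v *s v \<in> T"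
    by metis
  have f_eq: "f u = f v" if uv: "u \<in> S" "v \<in> S" "u \<noteq> v" for u v
  proof -
    have "h (f u *s u) (f v *s v) = f u * (f v)\<^sup>2"
      using assms(1) uv by (simp add: pentad_def h_scale_left h_scale_right)
    moreover have "h (f u *s u) (f v *s v) = 0 \<or> h (f u *s u) (f v *s v) = 1"
      using assms(2) f uv by (auto simp: pentad_def)
    ultimately have "f u * (f v)\<^sup>2 = 1"
      using f uv by auto
    moreover have "f v * (f v)\<^sup>2 = 1"
      using f uv cube_eq by blast
    ultimately have "f u * (f v)\<^sup>2 = f v * (f v)\<^sup>2"
      by simp
    then show ?thesis
      using f uv by simp
  qed
  obtain u where "u \<in> S"
    using assms(1) by (fastforce simp: pentad_def)
  have "f u *s v \<in> T" if "v \<in> S" for v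
    using f[OF that] f_eq[OF \<open>u \<in> S\<close> that] by (cases "u = v") auto
  then have sub: "(\<lambda>v. f u *s v) ` S \<subseteq> T"
    by auto
  have "card ((\<lambda>v. f u *s v) ` S) = card S"
    using f[OF \<open>u \<in> S\<close>] by (intro card_image inj_onI) simp
  then have "T = (\<lambda>v. f u *s v) ` S"
    using sub assms(1,2) by (intro sym[OF card_subset_eq]) (auto simp: pentad_def)
  with that f \<open>u \<in> S\<close> show thesis by blast
qed

lemma quadrangle_points_of_unique:
  assumes "pentad S" "pentad T" "ovoid_of S = ovoid_of T"
  shows "quadrangle_points_of S = quadrangle_points_of T"
proof -
  obtain k where k: "k \<noteq> 0" "T = (\<lambda>v. k *s v) ` S"
    using ovoid_of_eqE[OF assms] .
  have "P \<in> {vec.span {u + v} | u v. u \<in> T \<and> v \<in> T \<and> u \<noteq> v} \<longleftrightarrow>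
      (\<exists>u\<in>S. \<exists>v\<in>S. k *s u \<noteq> k *s v \<and> P = vec.span {k *s (u + v)})" for P
    unfolding k(2) vector_add_ldistrib by blast
  then have "{vec.span {u + v} | u v. u \<in> T \<and> v \<in> T \<and> u \<noteq> v} =
      {vec.span {u + v} | u v. u \<in> S \<and> v \<in> S \<and> u \<noteq> v}"
    unfolding span_singleton_scale[OF k(1)] using k(1) by (intro set_eqI) auto
  then show ?thesis
    using assms(3) by (simp add: quadrangle_points_of_def)
qed

end

subsection \<open>Projective spaces over the field of two elements\<close>

declare add_bit_eq_xor [simp del] mult_bit_eq_and [simp del] power_bit_unfold [simp del]

lemma proj_points_iff: "P \<in> proj_points \<longleftrightarrow> (\<exists>x. x \<noteq> 0 \<and> P = vec.span {x})"
proof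
  assume "P \<in> proj_points"
  then have P: "vec.subspace P" "vec.dim P = 1"
    by (auto simp: proj_points_def)
  obtain B where B: "B \<subseteq> P" "vec.independent B" "P \<subseteq> vec.span B" "card B = 1"
    using vec.basis_exists[of P] P(2) by metis
  then obtain x where x: "B = {x}"
    by (auto simp: card_1_singleton_iff)
  have "P = vec.span B"
    using B(1,3) P(1) by (metis vec.span_minimal subset_antisym)
  moreover have "x \<noteq> 0"
    using B(2) x vec.dependent_zero by blast
  ultimately show "\<exists>x. x \<noteq> 0 \<and> P = vec.span {x}"
    using x by blast
next
  assume "\<exists>x. x \<noteq> 0 \<and> P = vec.span {x}"
  then obtain x where "x \<noteq> 0" "P = vec.span {x}" by blast
  then show "P \<in> proj_points"
    by (simp add: proj_points_def vec.dim_eq_card_independent)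
qed

lemma proj_lines_iff:
  "l \<in> proj_lines \<longleftrightarrow> (\<exists>x y. vec.independent {x, y} \<and> x \<noteq> y \<and> l = vec.span {x, y})"
proof
  assume "l \<in> proj_lines"
  then have l: "vec.subspace l" "vec.dim l = 2"
    by (auto simp: proj_lines_def)
  obtain B where B: "B \<subseteq> l" "vec.independent B" "l \<subseteq> vec.span B" "card B = 2"
    using vec.basis_exists[of l] l(2) by metis
  then obtain x y where "B = {x, y}" "x \<noteq> y"
    by (auto simp: card_2_iff)
  moreover have "l = vec.span B"
    using B(1,3) l(1) by (metis vec.span_minimal subset_antisym)
  ultimately show "\<exists>x y. vec.independent {x, y} \<and> x \<noteq> y \<and> l = vec.span {x, y}"
    using B(2) by blast
next
  assume "\<exists>x y. vec.independent {x, y} \<and> x \<noteq> y \<and> l = vec.span {x, y}"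
  then obtain x y where "vec.independent {x, y}" "x \<noteq> y" "l = vec.span {x, y}" by blast
  then show "l \<in> proj_lines"
    by (simp add: proj_lines_def vec.dim_eq_card_independent)
qed

lemma bit_add_self [simp]: "(a::bit) + a = 0" and bit_add_self_left [simp]: "a + (a + b) = (b::bit)"
  and bit_minus [simp]: "a - b = a + (b::bit)"
  by (cases a; cases b; simp)+

lemma bitvec_add_self [simp]: "(x::bit^'n) + x = 0" and bitvec_add_self_left [simp]: "x + (x + y) = (y::bit^'n)"
  by (simp_all add: vec_eq_iff)

lemma bitvec_add_eq_0_iff [simp]: "(x::bit^'n) + y = 0 \<longleftrightarrow> x = y"
  by (metis add_left_cancel bitvec_add_self)

lemma bitvec_add_swap:
  assumes "a + b = c + (d::bit^'n)"
  shows "a + c = b + d"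
proof -
  have "a + c = (a + b) + (b + c)" by (simp add: add.assoc)
  also have "\<dots> = b + d" unfolding assms by (simp add: ac_simps)
  finally show ?thesis .
qed

lemma bit_scale_cases: "(k::bit) *s x = 0 \<or> k *s x = x"
  by (cases k) simp_all

lemma bit_span_singleton: "vec.span {x::bit^'n} = {0, x}"
proof -
  have "range (\<lambda>k::bit. k *s x) = {0, x}"
    by (auto intro: range_eqI[of _ _ 0] range_eqI[of _ _ 1] dest: bit_scale_cases[THEN disjE])
  then show ?thesis
    by (simp add: vec.span_singleton)
qed

lemma bit_span_pair: "vec.span {x, y::bit^'n} = {0, x, y, x + y}"
proof (intro equalityI subsetI)
  fix z assume "z \<in> vec.span {x, y}"
  then obtain k where "z - k *s x \<in> {0, y}"
    by (auto simp: vec.span_breakdown_eq bit_span_singleton)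
  then have "z = k *s x \<or> z = y + k *s x"
    by (auto simp: algebra_simps)
  then show "z \<in> {0, x, y, x + y}"
    using bit_scale_cases[of k x] by (auto simp: add.commute)
qed (auto intro: vec.span_zero vec.span_base vec.span_add)

lemma bit_independent_pair:
  "x \<noteq> y \<Longrightarrow> vec.independent {x, y::bit^'n} \<longleftrightarrow> x \<noteq> 0 \<and> y \<noteq> 0"
  by (auto simp: vec.independent_insert bit_span_singleton)

lemma bit_lines_iff:
  "l \<in> proj_lines \<longleftrightarrow> (\<exists>x y. x \<noteq> 0 \<and> y \<noteq> 0 \<and> x \<noteq> y \<and> l = vec.span {x, y::bit^'n})"
  unfolding proj_lines_iff using bit_independent_pair by metis

lemma card_bit: "CARD(bit) = 2"
proof -
  have "(UNIV :: bit set) = {0, 1}"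
    by (auto intro: bit_not_zero_iff[THEN iffD1])
  then have "CARD(bit) = card {0, 1::bit}"
    by (rule arg_cong)
  also have "\<dots> = 2" by simp
  finally show ?thesis .
qed

lemma card_bitvec4: "CARD(bit ^ 4) = 16"
  by (simp add: card_bit)

lemma finite_bitvec4: "finite (UNIV :: (bit ^ 4) set)"
  using card_bitvec4 by (intro card_ge_0_finite) simp

subsection \<open>Elliptic quadrics over the field of two elements\<close>

locale elliptic_form =
  fixes Q :: "bit ^ 4 \<Rightarrow> bit"
  assumes form: "nondegenerate_quadratic_form Q"
    and nonempty: "quadric Q \<noteq> {}"
    and no_line: "\<not> (\<exists>l\<in>proj_lines. \<forall>v\<in>l. Q v = 0)"
begin

definition B :: "bit ^ 4 \<Rightarrow> bit ^ 4 \<Rightarrow> bit" where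
  "B x y = Q (x + y) + Q x + Q y"

lemma Q_add: "Q (x + y) = Q x + Q y + B x y"
  by (simp add: B_def ac_simps)

lemma Q_zero [simp]: "Q 0 = 0"
proof -
  have "Q (0 *s 0) = 0\<^sup>2 * Q 0"
    using form unfolding nondegenerate_quadratic_form_def quadratic_form_def by blast
  then show ?thesis by simp
qed

lemma B_add_left: "B (x + y) z = B x z + B y z"
  and B_add_right: "B z (x + y) = B z x + B z y"
proof -
  have "bilinear_form (\<lambda>u v. Q (u + v) - Q u - Q v)"
    using form unfolding nondegenerate_quadratic_form_def quadratic_form_def by blast
  then have "bilinear_form B"
    by (simp add: B_def[abs_def] add.assoc)
  then show "B (x + y) z = B x z + B y z" "B z (x + y) = B z x + B z y"
    by (simp_all add: bilinear_form_def additive_form_def)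
qed

lemma B_commute: "B x y = B y x"
  by (simp add: B_def ac_simps)

lemma B_self [simp]: "B x x = 0"
  by (simp add: B_def)

lemma B_zero [simp]: "B 0 x = 0" "B x 0 = 0"
  by (simp_all add: B_def)

lemma ex_B: "x \<noteq> 0 \<Longrightarrow> Q x = 0 \<Longrightarrow> \<exists>y. B x y = 1"
proof -
  assume x: "x \<noteq> 0" "Q x = 0"
  have "\<exists>y. Q (x + y) - Q x - Q y \<noteq> 0"
    using form x unfolding nondegenerate_quadratic_form_def by blast
  then show ?thesis
    by (simp add: B_def add.assoc)
qed

lemma singular_pair:
  assumes "Q x = 0" "Q y = 0" "x \<noteq> 0" "y \<noteq> 0" "x \<noteq> y"
  shows "B x y = 1"
proof (rule ccontr)
  assume "B x y \<noteq> 1"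
  then have "\<forall>v\<in>vec.span {x, y}. Q v = 0"
    using assms by (auto simp: bit_span_pair Q_add)
  moreover have "vec.span {x, y} \<in> proj_lines"
    unfolding bit_lines_iff using assms by blast
  ultimately show False
    using no_line by blast
qed

definition Z :: "(bit ^ 4) set" where
  "Z = {x. x \<noteq> 0 \<and> Q x = 0}"

lemma B_Z: "x \<in> Z \<Longrightarrow> y \<in> Z \<Longrightarrow> B x y = of_bool (x \<noteq> y)"
  using singular_pair by (auto simp: Z_def)

lemma ex_notin_bitvec4:
  assumes "card X < 16"
  shows "\<exists>x::bit^4. x \<notin> X"
proof (rule ccontr)
  assume "\<not> ?thesis"
  then have "X = UNIV" by auto
  with assms card_bitvec4 show False by simp
qed

lemma card_set_less: "length xs < n \<Longrightarrow> card (set xs) < n"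
  using card_length[of xs] by linarith

text \<open>A hyperbolic pair \<open>p, q\<close> exists, the form is anisotropic on the complement of the pair, and
  adding \<open>p + q\<close> to nonzero vectors of the complement gives further singular vectors.\<close>
lemma ex_four_singular:
  obtains p q r s where "distinct [p, q, r, s]" "{p, q, r, s} \<subseteq> Z"
proof -
  obtain P where "P \<in> quadric Q"
    using nonempty by blast
  then obtain p where p: "p \<noteq> 0" "Q p = 0"
    unfolding quadric_def proj_points_iff using vec.span_base by fastforce
  then obtain q' where q': "B p q' = 1"
    using ex_B by blast
  define q where "q = (if Q q' = 0 then q' else p + q')"
  have q: "B p q = 1" "Q q = 0"
    using q' p by (auto simp: q_def Q_add B_add_right)
  then have q0: "q \<noteq> 0" "q \<noteq> p"
    by auto
  have B_pq: "B q p = 1"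
    using q(1) B_commute by simp
  define t where "t x = x + B x q *s p + B x p *s q" for x
  have t_perp: "B (t x) p = 0" "B (t x) q = 0" for x
    using q B_pq by (cases "B x q"; cases "B x p"; simp add: t_def B_add_left)+
  have Q_t: "Q (t x) = 1" if "x \<notin> {0, p, q, p + q}" for x
  proof (rule ccontr)
    assume "Q (t x) \<noteq> 1"
    moreover have t0: "t x \<noteq> 0"
      using that by (cases "B x q"; cases "B x p"; auto simp: t_def add.assoc)
    moreover have "t x \<noteq> p"
      using t_perp(2)[of x] q(1) by auto
    ultimately have "B (t x) p = 1"
      using p by (intro singular_pair) auto
    then show False using t_perp by simp
  qed
  have sing: "Q (p + q + t x) = 0" "B p (p + q + t x) = 1" if "x \<notin> {0, p, q, p + q}" for x
    using that p q Q_t[OF that] t_perp[of x] B_commute[of p "t x"]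
    by (simp_all add: Q_add B_add_left B_add_right B_commute[of _ "t x"])
  have "\<exists>x. x \<notin> set [0, p, q, p + q]"
    by (intro ex_notin_bitvec4 card_set_less) simp
  then obtain x where x: "x \<notin> {0, p, q, p + q}" by auto
  have "\<exists>y. y \<notin> set [0, p, q, p + q, x, x + p, x + q, x + p + q]"
    by (intro ex_notin_bitvec4 card_set_less) simp
  then obtain y where y: "y \<notin> {0, p, q, p + q, x, x + p, x + q, x + p + q}" by auto
  have txy: "t x \<noteq> t y"
  proof
    assume "t x = t y"
    then have "x + y = (B x q + B y q) *s p + (B x p + B y p) *s q"
      unfolding t_def add.assoc by (drule_tac bitvec_add_swap) (simp add: vector_sadd_rdistrib ac_simps)
    then have "x + y \<in> {0, p, q, p + q}"
      by (cases "B x q + B y q"; cases "B x p + B y p") auto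
    then have "y \<in> {x, x + p, x + q, x + (p + q)}"
      by (metis bitvec_add_self_left insert_iff add.right_neutral empty_iff)
    with y show False by (auto simp: add.assoc)
  qed
  have neq: "p + q + t z \<noteq> p" "p + q + t z \<noteq> q" "p + q + t z \<noteq> 0" if "z \<notin> {0, p, q, p + q}" for z
  proof -
    show "p + q + t z \<noteq> p" "p + q + t z \<noteq> 0"
      using sing(2)[OF that] by (metis B_self B_zero(2) zero_neq_one)+
    have "B q (p + q + t z) = 1"
      using t_perp(2)[of z] B_pq by (simp add: B_add_right B_commute[of q "t z"])
    then show "p + q + t z \<noteq> q"
      by (metis B_self zero_neq_one)
  qed
  show thesis
    using x y p q q0 neq sing(1) txy
    by (intro that[of p q "p + q + t x" "p + q + t y"]) (auto simp: Z_def)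
qed

lemma Z_structure:
  obtains p q r s where "distinct [p, q, r, s, p + q + r + s]" "Z = {p, q, r, s, p + q + r + s}"
    "\<And>x. x \<noteq> 0 \<Longrightarrow> x \<in> Z \<or> (\<exists>u\<in>Z. \<exists>v\<in>Z. u \<noteq> v \<and> x = u + v)"
proof -
  obtain p q r s where d: "distinct [p, q, r, s]" and sub: "{p, q, r, s} \<subseteq> Z"
    using ex_four_singular .
  have B1: "B p q = 1" "B p r = 1" "B p s = 1" "B q r = 1" "B q s = 1" "B r s = 1"
    "B q p = 1" "B r p = 1" "B s p = 1" "B r q = 1" "B s q = 1" "B s r = 1"
    using d sub B_Z by auto
  have Q0: "Q p = 0" "Q q = 0" "Q r = 0" "Q s = 0"
    using sub by (auto simp: Z_def)
  define f where "f = (\<lambda>(i::bit, j::bit, k::bit, l::bit). i *s p + j *s q + k *s r + l *s s)"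
  have B_scale: "B (k *s x) y = k * B x y" for k x y
    by (cases k) simp_all
  have f_B: "i = B (f (i,j,k,l)) q + B (f (i,j,k,l)) r + B (f (i,j,k,l)) s"
    "j = B (f (i,j,k,l)) p + B (f (i,j,k,l)) r + B (f (i,j,k,l)) s"
    "k = B (f (i,j,k,l)) p + B (f (i,j,k,l)) q + B (f (i,j,k,l)) s"
    "l = B (f (i,j,k,l)) p + B (f (i,j,k,l)) q + B (f (i,j,k,l)) r" for i j k l
    by (simp_all add: f_def B_add_left B_scale B1 ac_simps)
  have inj: "inj f"
    by (intro injI) (metis (no_types) f_B prod.exhaust)
  have "CARD(bit \<times> bit \<times> bit \<times> bit) = 16"
    by (simp add: card_bit)
  then have "card (range f) = CARD(bit ^ 4)"
    unfolding card_image[OF inj] card_bitvec4 .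
  then have "range f = UNIV"
    by (rule card_eq_UNIV_imp_eq_UNIV[OF finite_bitvec4])
  then have surj: "\<exists>i j k l. x = i *s p + j *s q + k *s r + l *s s" for x
    by (metis (no_types, lifting) UNIV_I f_def image_iff prod.exhaust case_prod_conv)
  have Qe: "Q (p + q + r + s) = 0" and Qt: "Q (p + q + r) = 1" "Q (p + q + s) = 1" "Q (p + r + s) = 1"
    "Q (q + r + s) = 1" and Qd: "Q (p + q) = 1" "Q (p + r) = 1" "Q (p + s) = 1" "Q (q + r) = 1"
    "Q (q + s) = 1" "Q (r + s) = 1"
    by (simp_all add: Q_add B_add_left B1 Q0)
  have e0: "p + q + r + s \<notin> {0, p, q, r, s}"
  proof -
    have "B (p + q + r + s) x = 1" if "x \<in> {p, q, r, s}" for x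
      using that by (auto simp: B_add_left B1)
    then show ?thesis
      by (metis B_self B_zero(1) insert_iff zero_neq_one)
  qed
  define e where "e = p + q + r + s"
  define prs where "prs = {(p,q), (p,r), (p,s), (q,r), (q,s), (r,s), (s,e), (r,e), (q,e), (p,e)}"
  have cases: "x \<in> {0, p, q, r, s, p + q + r + s} \<or> x \<in> (\<lambda>(u,v). u + v) ` prs" for x
  proof -
    obtain i j k l where "x = i *s p + j *s q + k *s r + l *s s"
      using surj by blast
    then show ?thesis
      unfolding prs_def e_def
      by (cases i; cases j; cases k; cases l) (simp_all add: ac_simps)
  qed
  have Z: "Z = {p, q, r, s, p + q + r + s}"
  proof (intro equalityI subsetI)
    fix x assume "x \<in> Z"
    then show "x \<in> {p, q, r, s, p + q + r + s}"
      using cases[of x] Qd Qt unfolding prs_def e_def by (auto simp: Z_def ac_simps)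
  next
    fix x assume "x \<in> {p, q, r, s, p + q + r + s}"
    then show "x \<in> Z"
      using sub e0 Qe by (auto simp: Z_def)
  qed
  have "prs \<subseteq> {(u, v). u \<in> Z \<and> v \<in> Z \<and> u \<noteq> v}"
    using d e0 unfolding prs_def Z e_def by simp
  then have prs: "x \<in> (\<lambda>(u,v). u + v) ` prs \<Longrightarrow> \<exists>u\<in>Z. \<exists>v\<in>Z. u \<noteq> v \<and> x = u + v" for x
    by fast
  have "x \<in> Z \<or> (\<exists>u\<in>Z. \<exists>v\<in>Z. u \<noteq> v \<and> x = u + v)" if "x \<noteq> 0" for x
  proof (cases "x \<in> Z")
    case False
    then have "x \<notin> {0, p, q, r, s, p + q + r + s}"
      using that unfolding Z by simp
    then show ?thesis
      using cases[of x] prs[of x] by argo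
  qed simp
  moreover have "distinct [p, q, r, s, p + q + r + s]"
    using d e0 by simp
  ultimately show thesis
    using that[of p q r s] Z by argo
qed

end

subsection \<open>Baer subgeometries\<close>

context elliptic_form
begin

lemma tangent_iff:
  assumes "x \<noteq> 0" "y \<noteq> 0" "x \<noteq> y"
  shows "card {r \<in> {x, y, x + y}. Q r = 0} = 1 \<longleftrightarrow> B x y = 0"
proof -
  have eq: "{r \<in> {x, y, x + y}. Q r = 0} =
      (if Q x = 0 then {x} else {}) \<union> (if Q y = 0 then {y} else {}) \<union>
      (if Q x + Q y + B x y = 0 then {x + y} else {})"
    by (auto simp: Q_add)
  have "B x y = 1" if "Q x = 0" "Q y = 0"
    using singular_pair assms that by blast
  then show ?thesis
    unfolding eq using assms by (cases "Q x"; cases "Q y"; cases "B x y") auto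
qed

lemma quadric_eq: "quadric Q = (\<lambda>x. vec.span {x}) ` Z"
proof -
  have "(\<forall>v\<in>vec.span {x}. Q v = 0) \<longleftrightarrow> Q x = 0" for x
    by (simp add: bit_span_singleton)
  then show ?thesis
    by (auto simp: quadric_def proj_points_iff Z_def)
qed

end

definition joins :: "('k::field ^ 'n) set set \<Rightarrow> ('k ^ 'n) set set" where
  "joins X = {vec.span (P \<union> R) | P R. P \<in> X \<and> R \<in> X \<and> P \<noteq> R}"

definition tangents :: "('k::field ^ 'n) set set \<Rightarrow> ('k ^ 'n) set set \<Rightarrow> ('k ^ 'n) set set" where
  "tangents X E = {l \<in> joins X. card {P \<in> E. P \<subseteq> l} = 1}"

lemma span_span_Un: "vec.span (vec.span X \<union> vec.span Y) = vec.span (X \<union> Y)"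
proof
  show "vec.span (vec.span X \<union> vec.span Y) \<subseteq> vec.span (X \<union> Y)"
    by (intro vec.span_minimal Un_least vec.span_mono vec.subspace_span) auto
  show "vec.span (X \<union> Y) \<subseteq> vec.span (vec.span X \<union> vec.span Y)"
    by (intro vec.span_mono Un_mono vec.span_superset)
qed

context hermitian_space4
begin

lemma of_bit_add: "of_bit (i + j) = of_bit i + (of_bit j :: 'k)"
  by (cases i; cases j) simp_all

lemma of_bit_mult: "of_bit (i * j) = of_bit i * (of_bit j :: 'k)"
  by (cases i; cases j) simp_all

definition bit_ext :: "bit ^ 4 \<Rightarrow> 'k ^ 4" where
  "bit_ext x = (\<chi> i. of_bit (x $ i))"

definition bvec :: "'k ^ 4 ^ 4 \<Rightarrow> bit ^ 4 \<Rightarrow> 'k ^ 4" where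
  "bvec M x = M *v bit_ext x"

lemma bit_ext_nth [simp]: "bit_ext x $ i = of_bit (x $ i)"
  by (simp add: bit_ext_def)

lemma baer_map_eq: "baer_map M U = vec.span (bvec M ` U)"
  by (simp add: baer_map_def bvec_def[abs_def] bit_ext_def[abs_def])

lemma bit_ext_add: "bit_ext (x + y) = bit_ext x + bit_ext y"
  by (simp add: vec_eq_iff of_bit_add)

lemma bvec_add: "bvec M (x + y) = bvec M x + bvec M y"
  by (simp add: bvec_def bit_ext_add matrix_vector_right_distrib)

lemma bvec_zero [simp]: "bvec M 0 = 0"
  using bvec_add[of M 0 0] by simp

lemma bvec_span: "bvec M x \<in> vec.span (bvec M ` X)" if "x \<in> vec.span X"
proof -
  have "vec.subspace {x. bvec M x \<in> vec.span (bvec M ` X)}"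
    unfolding vec.subspace_def
    by (auto simp: bvec_add vec.span_zero intro: vec.span_add)
      (metis bit_scale_cases bvec_zero vec.span_zero)
  then have "vec.span X \<subseteq> {x. bvec M x \<in> vec.span (bvec M ` X)}"
    by (intro vec.span_minimal) (auto intro: vec.span_base)
  with that show ?thesis by blast
qed

lemma baer_map_span: "baer_map M (vec.span X) = vec.span (bvec M ` X)"
proof
  show "baer_map M (vec.span X) \<subseteq> vec.span (bvec M ` X)"
    unfolding baer_map_eq by (rule vec.span_minimal) (auto intro: bvec_span)
  show "vec.span (bvec M ` X) \<subseteq> baer_map M (vec.span X)"
    unfolding baer_map_eq by (intro vec.span_mono image_mono vec.span_superset)
qed

lemma baer_points_eq: "baer_points M = (\<lambda>x. vec.span {bvec M x}) ` (- {0})"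
proof -
  have eq: "(proj_points :: (bit^4) set set) = (\<lambda>x. vec.span {x}) ` (- {0})"
    by (auto simp: proj_points_iff)
  show ?thesis
    unfolding baer_points_def eq image_image baer_map_span by simp
qed

lemma baer_lines_iff:
  "l \<in> baer_lines M \<longleftrightarrow>
    (\<exists>x y. x \<noteq> 0 \<and> y \<noteq> 0 \<and> x \<noteq> y \<and> l = vec.span {bvec M x, bvec M y})"
proof
  assume "l \<in> baer_lines M"
  then obtain l0 where "l0 \<in> proj_lines" "l = baer_map M l0"
    by (auto simp: baer_lines_def)
  then show "\<exists>x y. x \<noteq> 0 \<and> y \<noteq> 0 \<and> x \<noteq> y \<and> l = vec.span {bvec M x, bvec M y}"
    unfolding bit_lines_iff using baer_map_span[of M "{_, _}"] by force
next
  assume "\<exists>x y. x \<noteq> 0 \<and> y \<noteq> 0 \<and> x \<noteq> y \<and> l = vec.span {bvec M x, bvec M y}"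
  then obtain x y where xy: "x \<noteq> 0" "y \<noteq> 0" "x \<noteq> y" "l = vec.span {bvec M x, bvec M y}"
    by blast
  then have "l = baer_map M (vec.span {x, y})"
    by (simp add: baer_map_span)
  moreover have "vec.span {x, y} \<in> proj_lines"
    unfolding bit_lines_iff using xy by blast
  ultimately show "l \<in> baer_lines M"
    by (simp add: baer_lines_def)
qed

lemma h_span_zero:
  assumes "\<And>u v. u \<in> X \<Longrightarrow> v \<in> X \<Longrightarrow> h u v = 0" "u \<in> vec.span X" "v \<in> vec.span X"
  shows "h u v = 0"
proof -
  have 1: "vec.span X \<subseteq> {u. \<forall>v\<in>X. h u v = 0}"
    by (rule vec.span_minimal)
      (auto simp: vec.subspace_def h_add_left h_scale_left assms(1))
  have "vec.span X \<subseteq> {v. \<forall>u\<in>vec.span X. h u v = 0}"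
    by (rule vec.span_minimal)
      (use 1 in \<open>auto simp: vec.subspace_def h_add_right h_scale_right\<close>)
  with assms(2,3) show ?thesis by blast
qed

lemma bit_ext_eq_iff [simp]: "bit_ext x = bit_ext y \<longleftrightarrow> x = y"
proof
  assume "bit_ext x = bit_ext y"
  then have "of_bit (x $ i) = (of_bit (y $ i) :: 'k)" for i
    by (metis bit_ext_nth)
  then have "x $ i = y $ i" for i
    by (cases "x $ i"; cases "y $ i") (metis even_zero odd_one of_bool_eq zero_neq_one)+
  then show "x = y" by (simp add: vec_eq_iff)
qed simp

lemma bit_nonzero_nth: "x \<noteq> 0 \<Longrightarrow> \<exists>i. (x::bit^4) $ i = 1"
  by (simp add: vec_eq_iff)

lemma bit_ext_in_span1:
  assumes "bit_ext x = k *s bit_ext p" "p \<noteq> 0"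
  shows "x = 0 \<or> x = p"
proof -
  have e: "of_bit (x $ i) = k * of_bit (p $ i)" for i
    using assms(1) by (metis bit_ext_nth vector_smult_component)
  obtain i where "p $ i = 1"
    using assms(2) bit_nonzero_nth by blast
  then have "k = of_bit (x $ i)"
    using e[of i] by simp
  then have "k = 0 \<or> k = 1"
    by (cases "x $ i") simp_all
  then have "bit_ext x = bit_ext 0 \<or> bit_ext x = bit_ext p"
    using assms(1) by (auto simp: vec_eq_iff)
  then show ?thesis by simp
qed

lemma bit_ext_in_span2:
  assumes "bit_ext x = k *s bit_ext p + j *s bit_ext q" "p \<noteq> 0" "q \<noteq> 0" "p \<noteq> q"
  shows "x \<in> {0, p, q, p + q}"
proof -
  have e: "of_bit (x $ i) = k * of_bit (p $ i) + j * of_bit (q $ i)" for i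
    using assms(1) by (metis bit_ext_nth vector_smult_component vector_add_component)
  have bits: "of_bit i = (0::'k) \<or> of_bit i = (1::'k)" for i :: bit
    by (cases i) simp_all
  obtain i where i: "p $ i \<noteq> q $ i"
    using assms(4) by (auto simp: vec_eq_iff)
  obtain ip where ip: "p $ ip = 1"
    using assms(2) bit_nonzero_nth by blast
  obtain iq where iq: "q $ iq = 1"
    using assms(3) bit_nonzero_nth by blast
  have kj: "(k = 0 \<or> k = 1) \<and> (j = 0 \<or> j = 1)"
  proof (cases "p $ i")
    case zero
    then have "j = of_bit (x $ i)"
      using e[of i] i by (cases "q $ i") simp_all
    then have j: "j = 0 \<or> j = 1"
      using bits by metis
    have "k = of_bit (x $ ip) + j * of_bit (q $ ip)"
      unfolding e[of ip] using ip by (simp add: add.assoc)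
    then show ?thesis
      using j by (cases "x $ ip"; cases "q $ ip") auto
  next
    case one
    then have "k = of_bit (x $ i)"
      using e[of i] i by (cases "q $ i") simp_all
    then have k: "k = 0 \<or> k = 1"
      using bits by metis
    have "j = of_bit (x $ iq) + k * of_bit (p $ iq)"
      unfolding e[of iq] using iq by (simp add: ac_simps)
    then show ?thesis
      using k by (cases "x $ iq"; cases "p $ iq") auto
  qed
  have "bit_ext x = bit_ext 0 \<or> bit_ext x = bit_ext p \<or> bit_ext x = bit_ext q \<or> bit_ext x = bit_ext (p + q)"
    using kj assms(1) by (auto simp: bit_ext_add) (auto simp: vec_eq_iff)
  then show ?thesis by simp
qed

context
  fixes M :: "'k ^ 4 ^ 4"
  assumes M: "invertible M"
begin

lemma M_eq_iff: "M *v u = M *v v \<longleftrightarrow> u = v"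
proof -
  obtain N where "N ** M = mat 1"
    using M by (auto simp: invertible_def)
  then show ?thesis
    by (metis matrix_vector_mul_assoc matrix_vector_mul_lid)
qed

lemma bvec_eq_iff: "bvec M x = bvec M y \<longleftrightarrow> x = y"
  by (simp add: bvec_def M_eq_iff)

lemma bvec_eq_0_iff: "bvec M x = 0 \<longleftrightarrow> x = 0"
  using bvec_eq_iff[of x 0] by simp

lemma bvec_in_span1:
  assumes "bvec M x \<in> vec.span {bvec M p}" "p \<noteq> 0"
  shows "x = 0 \<or> x = p"
proof -
  obtain k where "bvec M x = k *s bvec M p"
    using assms(1) by (auto simp: vec.span_singleton)
  then have "M *v bit_ext x = M *v (k *s bit_ext p)"
    by (simp add: bvec_def vec.scale)
  then show ?thesis
    using bit_ext_in_span1[OF _ assms(2)] M_eq_iff by blast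
qed

lemma bvec_in_span2:
  assumes "bvec M x \<in> vec.span {bvec M p, bvec M q}" "p \<noteq> 0" "q \<noteq> 0" "p \<noteq> q"
  shows "x \<in> {0, p, q, p + q}"
proof -
  obtain k where "bvec M x - k *s bvec M p \<in> vec.span {bvec M q}"
    using assms(1) by (auto simp: vec.span_breakdown_eq)
  then obtain j where "bvec M x - k *s bvec M p = j *s bvec M q"
    by (auto simp: vec.span_singleton)
  then have "bvec M x = k *s bvec M p + j *s bvec M q"
    by (metis add.commute diff_add_cancel)
  then have "M *v bit_ext x = M *v (k *s bit_ext p + j *s bit_ext q)"
    by (simp add: bvec_def vec.scale matrix_vector_right_distrib)
  then show ?thesis
    using bit_ext_in_span2[OF _ assms(2-4)] M_eq_iff by blast
qed

lemma bvec_independent: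
  assumes "x \<noteq> 0" "y \<noteq> 0" "x \<noteq> y"
  shows "vec.independent {bvec M x, bvec M y}"
  using bvec_in_span1[of x y] assms
  by (auto simp: vec.independent_insert bvec_eq_0_iff)

lemma bvec_point_eq_iff:
  assumes "x \<noteq> 0" "y \<noteq> 0"
  shows "vec.span {bvec M x} = vec.span {bvec M y} \<longleftrightarrow> x = y"
  using bvec_in_span1[of x y] assms vec.span_base[of "bvec M x" "{bvec M x}"] by auto

lemma baer_lines_eq_joins: "baer_lines M = joins (baer_points M)"
proof -
  have sp: "vec.span (vec.span {bvec M x} \<union> vec.span {bvec M y}) = vec.span {bvec M x, bvec M y}" for x y
    by (simp add: span_span_Un insert_commute)
  have "l \<in> joins (baer_points M) \<longleftrightarrow>
      (\<exists>x y. x \<noteq> 0 \<and> y \<noteq> 0 \<and> x \<noteq> y \<and> l = vec.span {bvec M x, bvec M y})" for l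
  proof
    assume "l \<in> joins (baer_points M)"
    then obtain x y where "x \<noteq> 0" "y \<noteq> 0" "vec.span {bvec M x} \<noteq> vec.span {bvec M y}"
      "l = vec.span (vec.span {bvec M x} \<union> vec.span {bvec M y})"
      by (auto simp: joins_def baer_points_eq)
    then show "\<exists>x y. x \<noteq> 0 \<and> y \<noteq> 0 \<and> x \<noteq> y \<and> l = vec.span {bvec M x, bvec M y}"
      unfolding sp by blast
  next
    assume "\<exists>x y. x \<noteq> 0 \<and> y \<noteq> 0 \<and> x \<noteq> y \<and> l = vec.span {bvec M x, bvec M y}"
    then obtain x y where "x \<noteq> 0" "y \<noteq> 0" "x \<noteq> y"
      "l = vec.span (vec.span {bvec M x} \<union> vec.span {bvec M y})"
      unfolding sp by blast
    then show "l \<in> joins (baer_points M)"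
      unfolding joins_def baer_points_eq using bvec_point_eq_iff[of x y] by blast
  qed
  then show ?thesis
    by (intro set_eqI) (simp only: baer_lines_iff)
qed

lemma card_ovoid_on_line:
  assumes "x \<noteq> 0" "y \<noteq> 0" "x \<noteq> y" "0 \<notin> Z"
  shows "card {P \<in> (\<lambda>x. vec.span {bvec M x}) ` Z. P \<subseteq> vec.span {bvec M x, bvec M y}} =
    card {r \<in> {x, y, x + y}. r \<in> Z}"
proof -
  have "{P \<in> (\<lambda>x. vec.span {bvec M x}) ` Z. P \<subseteq> vec.span {bvec M x, bvec M y}} =
    (\<lambda>x. vec.span {bvec M x}) ` {r \<in> {x, y, x + y}. r \<in> Z}"
  proof (intro equalityI subsetI)
    fix P assume "P \<in> {P \<in> (\<lambda>x. vec.span {bvec M x}) ` Z. P \<subseteq> vec.span {bvec M x, bvec M y}}"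
    then obtain r where r: "r \<in> Z" "P = vec.span {bvec M r}" "P \<subseteq> vec.span {bvec M x, bvec M y}"
      by blast
    then have "bvec M r \<in> vec.span {bvec M x, bvec M y}"
      using vec.span_base[of "bvec M r" "{bvec M r}"] by auto
    then have "r \<in> {0, x, y, x + y}"
      using bvec_in_span2 assms by blast
    then have "r \<in> {r \<in> {x, y, x + y}. r \<in> Z}"
      using r(1) assms(4) by auto
    then show "P \<in> (\<lambda>x. vec.span {bvec M x}) ` {r \<in> {x, y, x + y}. r \<in> Z}"
      using r(2) by blast
  next
    fix P assume "P \<in> (\<lambda>x. vec.span {bvec M x}) ` {r \<in> {x, y, x + y}. r \<in> Z}"
    then obtain r where r: "r \<in> {x, y, x + y}" "r \<in> Z" "P = vec.span {bvec M r}"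
      by blast
    have "bvec M x + bvec M y \<in> vec.span {bvec M x, bvec M y}"
      by (intro vec.span_add vec.span_base) simp_all
    then have "bvec M r \<in> vec.span {bvec M x, bvec M y}"
      using r(1) by (auto simp: bvec_add intro: vec.span_base)
    then have "P \<subseteq> vec.span {bvec M x, bvec M y}"
      unfolding r(3) by (intro vec.span_minimal) auto
    with r show "P \<in> {P \<in> (\<lambda>x. vec.span {bvec M x}) ` Z. P \<subseteq> vec.span {bvec M x, bvec M y}}"
      by blast
  qed
  moreover have "inj_on (\<lambda>x. vec.span {bvec M x}) {r \<in> {x, y, x + y}. r \<in> Z}"
    by (rule inj_onI) (metis (mono_tags, lifting) assms(4) bvec_point_eq_iff mem_Collect_eq)
  ultimately show ?thesis
    by (simp add: card_image)
qed

lemma bvec_total: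
  assumes "\<And>x. h u (bvec M x) = 0"
  shows "u = 0"
proof -
  have col: "column i M = bvec M (axis i 1)" for i
    by (simp add: vec_eq_iff bvec_def matrix_vector_mult_def column_def axis_def
        if_distrib[of odd] if_distrib[of of_bool] if_distrib[of "(*) _"] cong: if_cong)
  have "h u v = 0" for v
  proof -
    obtain N where "M ** N = mat 1"
      using M by (auto simp: invertible_def)
    then have "v = M *v (N *v v)"
      by (simp add: matrix_vector_mul_assoc)
    also have "\<dots> = (\<Sum>i\<in>UNIV. (N *v v) $ i *s bvec M (axis i 1))"
      by (simp add: matrix_mult_sum[of M] col)
    finally have "h u v = h u (\<Sum>i\<in>UNIV. (N *v v) $ i *s bvec M (axis i 1))"
      by (rule arg_cong)
    then show ?thesis
      by (simp add: sum_4 h_add_right h_scale_right assms)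
  qed
  then show ?thesis
    using nondegenerate unfolding nondegenerate_form_def by blast
qed

end

end

subsection \<open>Ovoids and pentads\<close>

definition jform :: "'a::field ^ 4 \<Rightarrow> 'a ^ 4 \<Rightarrow> 'a" where
  "jform x y = x$1 * (y$2 + y$3 + y$4) + x$2 * (y$1 + y$3 + y$4) +
     x$3 * (y$1 + y$2 + y$4) + x$4 * (y$1 + y$2 + y$3)"

lemma jform_add_left: "jform (x + y) z = jform x z + jform y z"
  and jform_add_right: "jform z (x + y) = jform z x + jform z y"
  and jform_scale_left: "jform (k *s x) z = k * jform x z"
  and jform_scale_right: "jform z (k *s x) = k * jform z x"
  by (simp_all add: jform_def algebra_simps)

lemma alternating_jform:
  assumes char2: "\<And>k::'a::field. k + k = 0"
  shows "alternating_form (jform :: 'a ^ 4 \<Rightarrow> _)"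
proof -
  have "jform x x = (0::'a)" for x
  proof -
    define y where "y = x$1 * (x$2 + x$3 + x$4) + x$2 * (x$3 + x$4) + x$3 * x$4"
    have "jform x x = y + y"
      by (simp add: jform_def y_def algebra_simps)
    then show ?thesis by (simp add: char2)
  qed
  then show ?thesis
    by (simp add: alternating_form_def bilinear_form_def additive_form_def jform_add_left
        jform_add_right jform_scale_left jform_scale_right)
qed

lemma nondegenerate_jform:
  assumes char2: "\<And>k::'a::field. k + k = 0"
  shows "nondegenerate_form (jform :: 'a ^ 4 \<Rightarrow> _)"
proof -
  have "x = 0" if "\<forall>y. jform x y = 0" for x :: "'a ^ 4"
  proof -
    have e: "x$2 + x$3 + x$4 = 0" "x$1 + x$3 + x$4 = 0" "x$1 + x$2 + x$4 = 0" "x$1 + x$2 + x$3 = 0"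
      using that[rule_format, of "axis 1 1"] that[rule_format, of "axis 2 1"]
        that[rule_format, of "axis 3 1"] that[rule_format, of "axis 4 1"]
      by (simp_all add: jform_def axis_def)
    have char2': "k + (k + j) = j" for k j :: 'a
      by (simp add: char2 flip: add.assoc)
    have "x$1 = (x$1 + x$3 + x$4) + (x$1 + x$2 + x$4) + (x$1 + x$2 + x$3)"
      "x$2 = (x$2 + x$3 + x$4) + (x$1 + x$2 + x$4) + (x$1 + x$2 + x$3)"
      "x$3 = (x$2 + x$3 + x$4) + (x$1 + x$3 + x$4) + (x$1 + x$2 + x$3)"
      "x$4 = (x$2 + x$3 + x$4) + (x$1 + x$3 + x$4) + (x$1 + x$2 + x$4)"
      by (simp_all only: ac_simps char2 char2' add_0_right add_0_left)
    then have "x$1 = 0" "x$2 = 0" "x$3 = 0" "x$4 = 0"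
      unfolding e by simp_all
    then show ?thesis
      by (simp add: vec_eq_iff forall_4)
  qed
  then show ?thesis
    unfolding nondegenerate_form_def by blast
qed

definition base_quadric :: "bit ^ 4 \<Rightarrow> bit" where
  "base_quadric x = x$1 * x$2 + x$1 * x$3 + x$1 * x$4 + x$2 * x$3 + x$2 * x$4 + x$3 * x$4"

lemma base_quadric_add: "base_quadric (x + y) = base_quadric x + base_quadric y + jform x y"
  by (simp add: base_quadric_def jform_def algebra_simps)

lemma base_quadric_singular:
  "x \<noteq> 0 \<and> base_quadric x = 0 \<longleftrightarrow> x \<in> {axis 1 1, axis 2 1, axis 3 1, axis 4 1, 1}"
  unfolding base_quadric_def
  by (cases "x$1"; cases "x$2"; cases "x$3"; cases "x$4")
    (simp_all add: vec_eq_iff forall_4 axis_def)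

lemma base_quadric_singular_pair:
  assumes "x \<in> {axis 1 1, axis 2 1, axis 3 1, axis 4 1, 1}"
    and "y \<in> {axis 1 1, axis 2 1, axis 3 1, axis 4 1, 1}" and "x \<noteq> y"
  shows "jform x y = (1::bit)"
  using assms by (auto simp: jform_def axis_def)

lemma elliptic_base: "elliptic_form base_quadric"
proof
  have polar: "(\<lambda>u v. base_quadric (u + v) - base_quadric u - base_quadric v) = jform"
    by (intro ext) (simp add: base_quadric_add ac_simps)
  have "base_quadric (c *s v) = c\<^sup>2 * base_quadric v" for c v
    by (cases c) (simp_all add: base_quadric_def)
  then have "quadratic_form base_quadric"
    unfolding quadratic_form_def polar
    using alternating_jform[where 'a=bit] by (simp add: alternating_form_def)
  moreover have "u = 0" if "\<forall>v. base_quadric (u + v) - base_quadric u - base_quadric v = 0" for u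
  proof -
    have "\<forall>v. jform u v = 0"
      using that by (simp flip: polar)
    then show ?thesis
      using nondegenerate_jform[where 'a=bit] by (auto simp: nondegenerate_form_def)
  qed
  ultimately show "nondegenerate_quadratic_form base_quadric"
    unfolding nondegenerate_quadratic_form_def by blast
  have one: "1 \<noteq> (0::bit^4)" "base_quadric 1 = 0"
    using base_quadric_singular[of 1] by simp_all
  have "base_quadric 0 = 0"
    by (simp add: base_quadric_def)
  with one have "vec.span {1} \<in> quadric base_quadric"
    unfolding quadric_def proj_points_iff mem_Collect_eq
    by (intro conjI exI[of _ 1] ballI) (auto simp: bit_span_singleton)
  then show "quadric base_quadric \<noteq> {}"
    by blast
  show "\<not> (\<exists>l\<in>proj_lines. \<forall>v\<in>l. base_quadric v = 0)"
  proof
    assume "\<exists>l\<in>proj_lines. \<forall>v\<in>l. base_quadric v = 0"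
    then obtain l where l: "l \<in> proj_lines" "\<forall>v\<in>l. base_quadric v = 0"
      by blast
    from l(1) obtain x y where xy: "x \<noteq> 0" "y \<noteq> 0" "x \<noteq> y" "l = vec.span {x, y}"
      unfolding bit_lines_iff by blast
    with l(2) have "base_quadric x = 0" "base_quadric y = 0" "base_quadric (x + y) = 0"
      by (simp_all add: bit_span_pair)
    then have "jform x y = 0"
      by (simp add: base_quadric_add)
    moreover have "x \<in> {axis 1 1, axis 2 1, axis 3 1, axis 4 1, 1}"
      "y \<in> {axis 1 1, axis 2 1, axis 3 1, axis 4 1, 1}"
      using xy \<open>base_quadric x = 0\<close> \<open>base_quadric y = 0\<close> base_quadric_singular by blast+
    ultimately show False
      using base_quadric_singular_pair[of x y] xy(3) by simp
  qed
qed

context hermitian_space4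
begin

lemma pentad_of_ovoid:
  assumes \<pi>: "\<And>U. vec.subspace U \<Longrightarrow> \<pi> U = form_perp h U"
    and W: "symplectic_subquadrangle \<pi> W" and E: "elliptic_ovoid W E"
  shows "\<exists>S. pentad S \<and> E = ovoid_of S \<and> fst W = quadrangle_points_of S \<and> snd W = tangents (fst W) E"
proof -
  obtain M E0 where M: "invertible M" and fst: "fst W = baer_points M" and "elliptic_quadric E0"
    and E_eq: "E = baer_map M ` E0" and snd: "snd W = {l \<in> baer_lines M. card {P \<in> E. P \<subseteq> l} = 1}"
    using E unfolding elliptic_ovoid_def by blast
  then obtain Q where "elliptic_form Q" and E0: "E0 = quadric Q"
    unfolding elliptic_quadric_def elliptic_form_def by blast
  then interpret elliptic_form Q by simp
  have E': "E = (\<lambda>x. vec.span {bvec M x}) ` Z"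
    unfolding E_eq E0 quadric_eq image_image baer_map_span by simp
  have iso: "h (bvec M x) (bvec M x) = 0" for x
  proof (cases "x = 0")
    case False
    then have "vec.span {bvec M x} \<in> isotropic_points \<pi>"
      using W fst unfolding symplectic_subquadrangle_def isotropic_geometry_def baer_points_eq by auto
    then have "vec.span {bvec M x} \<subseteq> form_perp h (vec.span {bvec M x})"
      by (simp add: isotropic_points_def \<pi>)
    then show ?thesis
      using vec.span_base[of "bvec M x" "{bvec M x}"] by (auto simp: form_perp_def)
  qed simp
  have h_bits: "h (bvec M x) (bvec M y) = 0 \<or> h (bvec M x) (bvec M y) = 1" for x y
  proof -
    have "h (bvec M x) (bvec M y) + h (bvec M y) (bvec M x) = 0"
      using iso[of "x + y"] by (simp add: bvec_add h_add_left h_add_right iso add.commute)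
    then have "h (bvec M x) (bvec M y) = (h (bvec M x) (bvec M y))\<^sup>2"
      using h_commute[of "bvec M y" "bvec M x"] by (simp add: add_eq_0_iff_eq)
    then show ?thesis
      using self_norm by blast
  qed
  have perp: "h (bvec M p) (bvec M q) = 0" if "p \<in> Z" "B p q = 0" for p q
  proof (cases "q = 0 \<or> q = p")
    case True
    then show ?thesis using iso by auto
  next
    case False
    have p: "p \<noteq> 0" "Q p = 0" "p \<noteq> q"
      using that(1) False by (auto simp: Z_def)
    define l where "l = vec.span {bvec M p, bvec M q}"
    have l: "l \<in> baer_lines M"
      unfolding baer_lines_iff l_def using p False by blast
    have "{r \<in> {p, q, p + q}. r \<in> Z} = {r \<in> {p, q, p + q}. Q r = 0}"
      using p False by (auto simp: Z_def)
    then have "card {P \<in> E. P \<subseteq> l} = 1"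
      unfolding E' l_def using card_ovoid_on_line[OF M, of p q Z] tangent_iff[of p q] p False that(2)
      by (simp add: Z_def)
    then have "l \<in> snd W"
      using l snd by simp
    then have "l \<in> isotropic_lines \<pi>"
      using W unfolding symplectic_subquadrangle_def isotropic_geometry_def by auto
    then have "l \<subseteq> form_perp h l"
      by (simp add: isotropic_lines_def \<pi> l_def)
    moreover have "bvec M p \<in> l" "bvec M q \<in> l"
      by (simp_all add: l_def vec.span_base)
    ultimately show ?thesis
      by (auto simp: form_perp_def)
  qed
  have one: "h (bvec M p) (bvec M q) = 1" if pq: "p \<in> Z" "q \<in> Z" "p \<noteq> q" for p q
  proof (rule ccontr)
    assume "h (bvec M p) (bvec M q) \<noteq> 1"
    then have 0: "h (bvec M p) (bvec M q) = 0"
      using h_bits by blast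
    have "h (bvec M p) (bvec M r) = 0" for r
    proof (cases "B p r")
      case zero
      then show ?thesis using perp pq(1) by blast
    next
      case one
      then have "B p (r + q) = 0"
        using B_Z[OF pq(1,2)] pq(3) by (simp add: B_add_right)
      then have "h (bvec M p) (bvec M (r + q)) = 0"
        using perp pq(1) by blast
      then show ?thesis
        by (simp add: bvec_add h_add_right 0)
    qed
    then have "bvec M p = 0"
      using bvec_total[OF M] by blast
    then show False
      using bvec_eq_0_iff[OF M] pq(1) by (simp add: Z_def)
  qed
  obtain p q r s where d: "distinct [p, q, r, s, p + q + r + s]" and Z: "Z = {p, q, r, s, p + q + r + s}"
    and gen: "\<And>x. x \<noteq> 0 \<Longrightarrow> x \<in> Z \<or> (\<exists>u\<in>Z. \<exists>v\<in>Z. u \<noteq> v \<and> x = u + v)"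
    by (rule Z_structure) (rule that; blast)
  have card_Z: "card Z = 5"
    using distinct_card[OF d] by (simp add: Z)
  have inj: "inj (bvec M)"
    by (simp add: inj_def bvec_eq_iff[OF M])
  define S where "S = bvec M ` Z"
  have "pentad S"
    unfolding pentad_def S_def using card_Z inj iso one
    by (auto simp: card_image inj_on_def bvec_eq_iff[OF M])
  moreover have "E = ovoid_of S"
    unfolding E' S_def ovoid_of_def image_image ..
  moreover have "fst W = quadrangle_points_of S"
  proof (intro equalityI subsetI)
    fix P assume "P \<in> fst W"
    then obtain x where x: "x \<noteq> 0" "P = vec.span {bvec M x}"
      using fst by (auto simp: baer_points_eq)
    from gen[OF x(1)] show "P \<in> quadrangle_points_of S"
    proof (elim disjE bexE conjE)
      assume "x \<in> Z"
      then show ?thesis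
        unfolding quadrangle_points_of_def ovoid_of_def S_def x(2) by blast
    next
      fix u v assume "u \<in> Z" "v \<in> Z" "u \<noteq> v" "x = u + v"
      then show ?thesis
        unfolding quadrangle_points_of_def S_def x(2)
        by (intro UnI2 CollectI exI[of _ "bvec M u"] exI[of _ "bvec M v"])
          (simp add: bvec_add bvec_eq_iff[OF M])
    qed
  next
    fix P assume "P \<in> quadrangle_points_of S"
    then consider x where "x \<in> Z" "P = vec.span {bvec M x}"
      | u v where "bvec M u \<noteq> bvec M v" "P = vec.span {bvec M u + bvec M v}"
      unfolding quadrangle_points_of_def ovoid_of_def S_def by blast
    then show "P \<in> fst W"
    proof cases
      case 1
      then show ?thesis
        by (auto simp: fst baer_points_eq Z_def)
    next
      case 2
      then have "u + v \<noteq> 0" "P = vec.span {bvec M (u + v)}"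
        by (auto simp: bvec_add)
      then show ?thesis
        unfolding fst baer_points_eq by blast
    qed
  qed
  moreover have "snd W = tangents (fst W) E"
    by (simp add: snd tangents_def fst baer_lines_eq_joins[OF M])
  ultimately show ?thesis by blast
qed

end

lemma alternating_form_double_perp:
  fixes f :: "'k::{field,finite} ^ 4 \<Rightarrow> 'k ^ 4 \<Rightarrow> 'k"
  assumes f: "alternating_form f"
    and represents: "\<And>g. Vector_Spaces.linear (*s) (*s) g \<Longrightarrow> \<exists>z. \<forall>u. f z u = (g u :: 'k ^ 4) $ 1"
    and U: "vec.subspace U"
  shows "form_perp f (form_perp f U) = U"
proof
  have add: "f (u + v) x = f u x + f v x" "f x (u + v) = f x u + f x v" and self: "f u u = 0" for u v x
    using f by (auto simp: alternating_form_def bilinear_form_def additive_form_def)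
  have "f u v + f v u = 0" for u v
  proof -
    have "f (u + v) (u + v) = f u u + f v u + (f u v + f v v)"
      by (simp only: add)
    then show ?thesis
      unfolding self by (simp add: add.commute)
  qed
  then have skew: "f u v = 0 \<Longrightarrow> f v u = 0" for u v
    by (metis add_0_left)
  then show "U \<subseteq> form_perp f (form_perp f U)"
    by (auto simp: form_perp_def)
  show "form_perp f (form_perp f U) \<subseteq> U"
  proof (rule ccontr)
    assume "\<not> ?thesis"
    then obtain x where x: "x \<in> form_perp f (form_perp f U)" "x \<notin> U"
      by blast
    obtain B where B: "B \<subseteq> U" "vec.independent B" "U \<subseteq> vec.span B"
      using vec.basis_exists[of U] by metis
    have "vec.span B = U"
      using B U by (simp add: subset_antisym vec.span_minimal)
    then have "vec.independent (insert x B)"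
      using B(2) x(2) by (simp add: vec.independent_insert)
    then obtain g where g: "Vector_Spaces.linear (*s) (*s) g"
      "\<forall>v\<in>insert x B. g v = (if v = x then axis 1 1 else 0 :: 'k ^ 4)"
      using vec.linear_independent_extend[of "insert x B" "\<lambda>v. if v = x then axis 1 1 else 0"] by blast
    obtain z where z: "\<And>u. f z u = g u $ 1"
      using represents[OF g(1)] by blast
    have "g v = 0" if "v \<in> vec.span B" for v
      using vec.linear_eq_0_on_span[OF g(1) _ that] g(2) x(2) B(1) by (metis insertCI subsetD)
    then have "f u z = 0" if "u \<in> U" for u
      using that \<open>vec.span B = U\<close> skew z by simp
    then have "z \<in> form_perp f U"
      by (simp add: form_perp_def)
    then have "f z x = 0"
      using x(1) by (simp add: form_perp_def)
    then show False
      using z[of x] g(2) by (simp add: axis_def)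
  qed
qed

context frame4
begin

definition frame_matrix :: "'k ^ 4 ^ 4" where
  "frame_matrix = (\<chi> i j. (if j = 1 then a else if j = 2 then b else if j = 3 then c else d) $ i)"

lemma frame_matrix_mult: "frame_matrix *v y = y$1 *s a + y$2 *s b + y$3 *s c + y$4 *s d"
  by (simp add: vec_eq_iff matrix_vector_mult_def sum_4 frame_matrix_def mult.commute)

definition cj :: "'k ^ 4 \<Rightarrow> 'k ^ 4" where
  "cj y = (\<chi> i. (y $ i)\<^sup>2)"

lemma cj_cj [simp]: "cj (cj y) = y"
  by (simp add: cj_def vec_eq_iff power4_eq flip: power_mult)

lemma cj_add: "cj (x + y) = cj x + cj y" and cj_scale: "cj (k *s y) = k\<^sup>2 *s cj y"
  by (simp_all add: cj_def vec_eq_iff square_add power_mult_distrib)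

lemma cj_bit_ext [simp]: "cj (bit_ext x) = bit_ext x"
  by (simp add: cj_def vec_eq_iff)

lemma jform_cj: "jform (cj x) (cj y) = (jform x y)\<^sup>2"
  by (simp add: jform_def cj_def square_add power_mult_distrib)

lemma jform_bit_ext: "jform (bit_ext x) (bit_ext y) = of_bit (jform x y)"
  unfolding jform_def by (simp only: of_bit_add of_bit_mult bit_ext_nth)

lemma h_frame_matrix: "h (frame_matrix *v y) (frame_matrix *v z) = jform y (cj z)"
  by (simp add: frame_matrix_mult frame_simps jform_def cj_def algebra_simps)

lemma frame_matrix_inverse:
  obtains N where "frame_matrix ** N = mat 1" "N ** frame_matrix = mat 1"
proof -
  have "y = 0" if "frame_matrix *v y = 0" for y
  proof -
    have "jform y z = 0" for z
      using h_frame_matrix[of y "cj z"] that by simp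
    then show ?thesis
      using nondegenerate_jform[OF add_self] unfolding nondegenerate_form_def by blast
  qed
  then show thesis
    using that matrix_left_invertible_ker[of frame_matrix] matrix_left_right_inverse by metis
qed

lemma invertible_frame_matrix: "invertible frame_matrix"
  using frame_matrix_inverse unfolding invertible_def by metis

definition coord_matrix :: "'k ^ 4 ^ 4" where
  "coord_matrix = (SOME N. frame_matrix ** N = mat 1 \<and> N ** frame_matrix = mat 1)"

lemma coord_matrix: "frame_matrix ** coord_matrix = mat 1" "coord_matrix ** frame_matrix = mat 1"
proof -
  have "\<exists>N. frame_matrix ** N = mat 1 \<and> N ** frame_matrix = mat 1"
    using frame_matrix_inverse by metis
  from someI_ex[OF this] show "frame_matrix ** coord_matrix = mat 1" "coord_matrix ** frame_matrix = mat 1"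
    unfolding coord_matrix_def by blast+
qed

lemma coord_inverse [simp]: "frame_matrix *v (coord_matrix *v u) = u" "coord_matrix *v (frame_matrix *v u) = u"
  by (simp_all add: matrix_vector_mul_assoc coord_matrix)

definition symplectic :: "'k ^ 4 \<Rightarrow> 'k ^ 4 \<Rightarrow> 'k" where
  "symplectic u v = jform (coord_matrix *v u) (coord_matrix *v v)"

definition conjugation :: "'k ^ 4 \<Rightarrow> 'k ^ 4" where
  "conjugation u = frame_matrix *v cj (coord_matrix *v u)"

lemma conjugation_conjugation [simp]: "conjugation (conjugation u) = u"
  by (simp add: conjugation_def)

lemma conjugation_add: "conjugation (u + v) = conjugation u + conjugation v"
  and conjugation_scale: "conjugation (k *s u) = k\<^sup>2 *s conjugation u"
  by (simp_all add: conjugation_def matrix_vector_right_distrib cj_add vec.scale cj_scale)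

lemma h_eq_symp: "h u v = symplectic u (conjugation v)"
  using h_frame_matrix[of "coord_matrix *v u" "coord_matrix *v v"]
  by (simp add: symplectic_def conjugation_def)

lemma symplectic_conjugation: "symplectic (conjugation u) (conjugation v) = (symplectic u v)\<^sup>2"
  by (simp add: symplectic_def conjugation_def jform_cj)

lemma alternating_symp: "alternating_form symplectic"
  using alternating_jform[OF add_self]
  by (simp add: alternating_form_def bilinear_form_def additive_form_def symplectic_def
      matrix_vector_right_distrib vec.scale)

lemma symplectic_simps: "symplectic (u + v) x = symplectic u x + symplectic v x" "symplectic x (u + v) = symplectic x u + symplectic x v"
  "symplectic (k *s u) x = k * symplectic u x" "symplectic x (k *s u) = k * symplectic x u"
  using alternating_symp by (auto simp: alternating_form_def bilinear_form_def additive_form_def)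

lemma symplectic_zero [simp]: "symplectic 0 x = 0" "symplectic x 0 = 0"
  using symplectic_simps(3)[of 0 0 x] symplectic_simps(4)[of x 0 0] by simp_all

lemma nondegenerate_symp: "nondegenerate_form symplectic"
  unfolding nondegenerate_form_def
proof (intro allI impI)
  fix u assume "\<forall>v. symplectic u v = 0"
  then have "jform (coord_matrix *v u) y = 0" for y
    by (metis coord_inverse(2) symplectic_def)
  then have "coord_matrix *v u = 0"
    using nondegenerate_jform[OF add_self] unfolding nondegenerate_form_def by blast
  then show "u = 0"
    by (metis coord_inverse(1) matrix_vector_mult_0_right)
qed

lemma symplectic_represents:
  assumes "Vector_Spaces.linear (*s) (*s) g"
  shows "\<exists>z. \<forall>u. symplectic z u = (g u :: 'k ^ 4) $ 1"
proof -
  interpret g: Vector_Spaces.linear "(*s)" "(*s)" g by fact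
  define z :: "'k ^ 4" where "z = frame_matrix *v (\<chi> i. if i = 1 then g (b + c + d) $ 1 else if i = 2 then g (a + c + d) $ 1
    else if i = 3 then g (a + b + d) $ 1 else g (a + b + c) $ 1)"
  have "symplectic z u = g u $ 1" for u
  proof -
    define y where "y = coord_matrix *v u"
    have "u = y$1 *s a + y$2 *s b + y$3 *s c + y$4 *s d"
      by (metis y_def coord_inverse(1) frame_matrix_mult)
    then have "g u $ 1 = y$1 * g a $ 1 + y$2 * g b $ 1 + y$3 * g c $ 1 + y$4 * g d $ 1"
      by (simp add: g.add g.scale)
    moreover have "symplectic z u = y$1 * g a $ 1 + y$2 * g b $ 1 + y$3 * g c $ 1 + y$4 * g d $ 1"
      by (simp add: symplectic_def z_def jform_def g.add algebra_simps flip: y_def)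
    ultimately show ?thesis by simp
  qed
  then show ?thesis by blast
qed

lemmas symplectic_double_perp = alternating_form_double_perp[OF alternating_symp symplectic_represents]

lemma conjugation_bvec [simp]: "conjugation (bvec frame_matrix x) = bvec frame_matrix x"
  by (simp add: conjugation_def bvec_def)

lemma bvec_frame:
  "bvec frame_matrix (axis 1 1) = a" "bvec frame_matrix (axis 2 1) = b"
  "bvec frame_matrix (axis 3 1) = c" "bvec frame_matrix (axis 4 1) = d"
  "bvec frame_matrix 1 = a + b + c + d"
  by (simp_all add: bvec_def frame_matrix_mult axis_def)

lemma h_bvec: "h (bvec frame_matrix x) (bvec frame_matrix y) = of_bit (jform x y)"
  by (simp add: bvec_def h_frame_matrix jform_bit_ext)

lemma symplectic_bvec: "symplectic (bvec frame_matrix x) (bvec frame_matrix y) = of_bit (jform x y)"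
  using h_eq_symp[of "bvec frame_matrix x" "bvec frame_matrix y"] by (simp add: h_bvec)

lemma conjugation_fixed_points: "fixed_points conjugation = baer_points frame_matrix"
proof (intro equalityI subsetI)
  fix P assume "P \<in> fixed_points conjugation"
  then obtain u where u: "u \<noteq> 0" "P = vec.span {u}" "conjugation ` P = P"
    by (auto simp: fixed_points_def proj_points_iff)
  then have "conjugation u \<in> vec.span {u}"
    using vec.span_base[of u "{u}"] by blast
  then obtain k where k: "conjugation u = k *s u"
    by (auto simp: vec.span_singleton)
  then have "k \<noteq> 0"
    using u(1) conjugation_conjugation[of u] conjugation_scale[of 0 0] by auto
  define v where "v = inverse k *s u"
  have "(inverse k)\<^sup>2 * k = inverse k"
    using \<open>k \<noteq> 0\<close> by (simp add: power2_eq_square)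
  then have "conjugation v = v"
    by (simp add: v_def conjugation_scale k)
  define y where "y = coord_matrix *v v"
  have y: "v = frame_matrix *v y" "cj y = y"
    using arg_cong[OF \<open>conjugation v = v\<close>, of "(*v) coord_matrix"]
    by (simp_all add: y_def conjugation_def)
  then have "y $ i = 0 \<or> y $ i = 1" for i
    using self_norm[of "y $ i"] by (metis cj_def vec_lambda_beta)
  then have "y = bit_ext (\<chi> i. if y $ i = 0 then 0 else 1)"
    by (auto simp: vec_eq_iff)
  then obtain x where x: "v = bvec frame_matrix x"
    using y(1) by (metis bvec_def)
  have "P = vec.span {v}"
    using \<open>k \<noteq> 0\<close> by (simp add: u(2) v_def span_singleton_scale)
  moreover have "x \<noteq> 0"
    using x u(1) \<open>k \<noteq> 0\<close> by (auto simp: v_def)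
  ultimately show "P \<in> baer_points frame_matrix"
    unfolding baer_points_eq x by blast
next
  fix P assume "P \<in> baer_points frame_matrix"
  then obtain x where x: "x \<noteq> 0" "P = vec.span {bvec frame_matrix x}"
    by (auto simp: baer_points_eq)
  have "conjugation u \<in> P" if "u \<in> P" for u
    using that by (auto simp: x(2) vec.span_singleton conjugation_scale)
  then have "conjugation ` P = P"
    by (metis conjugation_conjugation image_subsetI subset_antisym image_eqI subsetI)
  moreover have "P \<in> proj_points"
    unfolding proj_points_iff x(2) using bvec_eq_0_iff[OF invertible_frame_matrix] x(1) by blast
  ultimately show "P \<in> fixed_points conjugation"
    by (simp add: fixed_points_def)
qed

lemma semilinear_involution_conjugation: "semilinear_involution conjugation"
proof -
  have bij: "bij conjugation"
    by (rule involuntory_imp_bij) simp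
  have "bij (\<lambda>k::'k. k\<^sup>2)"
    by (rule involuntory_imp_bij) (simp add: power4_eq flip: power_mult)
  then have "semilinear conjugation"
    unfolding semilinear_def using conjugation_add conjugation_scale
    by (intro exI[of _ "\<lambda>k. k\<^sup>2"]) (simp add: square_add power_mult_distrib)
  moreover define u where "u = a + w *s b"
  have "h u b = 1"
    by (simp add: u_def frame_simps)
  then have "u \<noteq> 0" by auto
  have "conjugation ` vec.span {u} \<noteq> vec.span {u}"
  proof
    assume "conjugation ` vec.span {u} = vec.span {u}"
    then have "conjugation u \<in> vec.span {u}"
      using vec.span_base[of u "{u}"] by blast
    then obtain k where k: "conjugation u = k *s u"
      by (auto simp: vec.span_singleton)
    have "conjugation u = a + w\<^sup>2 *s b"
      using conjugation_bvec[of "axis 1 1"] conjugation_bvec[of "axis 2 1"]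
      by (simp add: u_def conjugation_add conjugation_scale bvec_frame)
    then have "h (a + w\<^sup>2 *s b) v = k * h (a + w *s b) v" for v
      using k by (metis h_scale_left u_def)
    from this[of b] this[of a] have "w\<^sup>2 = w"
      by (simp add: frame_simps)
    then show False
      using w_neq self_norm[of w] by simp
  qed
  moreover have "vec.span {u} \<in> proj_points"
    unfolding proj_points_iff using \<open>u \<noteq> 0\<close> by blast
  moreover have "conjugation ` conjugation ` P = P" for P
    by (simp add: image_image)
  ultimately show ?thesis
    unfolding semilinear_involution_def using bij by blast
qed

lemma perp_baer_map:
  "form_perp symplectic (baer_map frame_matrix U) = baer_map frame_matrix (form_perp jform U)"
proof (intro equalityI subsetI)
  fix v assume v: "v \<in> form_perp symplectic (baer_map frame_matrix U)"
  define y where "y = coord_matrix *v v"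
  have "k = of_bit 0 + w * of_bit 0 \<or> k = of_bit 1 + w * of_bit 0 \<or>
      k = of_bit 0 + w * of_bit 1 \<or> k = of_bit 1 + w * of_bit 1" for k
    using field_cases[of k] by (simp add: add.commute)
  then have "\<exists>i j. k = of_bit i + w * of_bit j" for k
    by blast
  then obtain f g where fg: "\<And>k. k = of_bit (f k) + w * of_bit (g k)"
    by metis
  define y0 where "y0 = (\<chi> i. f (y $ i))"
  define y1 where "y1 = (\<chi> i. g (y $ i))"
  have y: "y = bit_ext y0 + w *s bit_ext y1"
    unfolding vec_eq_iff y0_def y1_def vector_add_component vector_smult_component bit_ext_nth
      vec_lambda_beta by (intro allI fg)
  have "v = frame_matrix *v y"
    by (simp add: y_def)
  then have v_eq: "v = bvec frame_matrix y0 + w *s bvec frame_matrix y1"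
    by (simp add: y bvec_def matrix_vector_right_distrib vec.scale)
  have "jform x y0 = 0 \<and> jform x y1 = 0" if "x \<in> U" for x
  proof -
    have "bvec frame_matrix x \<in> baer_map frame_matrix U"
      unfolding baer_map_eq using that by (intro vec.span_base) blast
    then have "symplectic (bvec frame_matrix x) v = 0"
      using v by (simp add: form_perp_def)
    then have "of_bit (jform x y0) + w * of_bit (jform x y1) = 0"
      by (simp only: v_eq symplectic_simps symplectic_bvec)
    then show ?thesis
      using w_neq by (cases "jform x y0"; cases "jform x y1") (auto simp: add_eq_0_iff_eq)
  qed
  then have "y0 \<in> form_perp jform U" "y1 \<in> form_perp jform U"
    by (simp_all add: form_perp_def)
  then show "v \<in> baer_map frame_matrix (form_perp jform U)"
    unfolding baer_map_eq v_eq by (intro vec.span_add vec.span_scale vec.span_base) auto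
next
  fix v assume v: "v \<in> baer_map frame_matrix (form_perp jform U)"
  have "baer_map frame_matrix U \<subseteq> {u. symplectic u (bvec frame_matrix y) = 0}" if "y \<in> form_perp jform U" for y
    unfolding baer_map_eq
    using that by (intro vec.span_minimal)
      (auto simp: vec.subspace_def symplectic_simps symplectic_bvec form_perp_def)
  then have "baer_map frame_matrix (form_perp jform U) \<subseteq> form_perp symplectic (baer_map frame_matrix U)"
    unfolding baer_map_eq[of _ "form_perp jform U"]
    by (intro vec.span_minimal) (auto simp: vec.subspace_def symplectic_simps form_perp_def)
  with v show "v \<in> form_perp symplectic (baer_map frame_matrix U)"
    by blast
qed

lemma perp_conjugation: "form_perp symplectic (conjugation ` U) = conjugation ` form_perp symplectic U"
proof (intro equalityI subsetI)
  fix v assume "v \<in> form_perp symplectic (conjugation ` U)"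
  then have "(symplectic u (conjugation v))\<^sup>2 = 0" if "u \<in> U" for u
    using that by (simp add: form_perp_def flip: symplectic_conjugation)
  then have "conjugation v \<in> form_perp symplectic U"
    by (simp add: form_perp_def)
  then show "v \<in> conjugation ` form_perp symplectic U"
    by (metis conjugation_conjugation image_eqI)
qed (auto simp: form_perp_def symplectic_conjugation)

lemma h_perp: "form_perp h U = conjugation ` form_perp symplectic U"
proof (intro equalityI subsetI)
  fix v assume "v \<in> form_perp h U"
  then have "conjugation v \<in> form_perp symplectic U"
    by (simp add: form_perp_def h_eq_symp)
  then show "v \<in> conjugation ` form_perp symplectic U"
    by (metis conjugation_conjugation image_eqI)
qed (auto simp: form_perp_def h_eq_symp)

lemma subspace_perp: "vec.subspace (form_perp symplectic U)" "vec.subspace (form_perp h U)"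
  by (auto simp: vec.subspace_def form_perp_def symplectic_simps h_add_right h_scale_right)

definition frame_lines :: "('k ^ 4) set set" where
  "frame_lines = baer_map frame_matrix ` isotropic_lines (form_perp jform)"

lemma isotropic_lines_jform:
  "isotropic_lines (form_perp jform) =
    {vec.span {x, y} | x y. x \<noteq> 0 \<and> y \<noteq> 0 \<and> x \<noteq> y \<and> jform x y = (0::bit)}"
proof -
  have alt: "jform x x = (0::bit)" for x
    using alternating_jform[where 'a=bit] by (simp add: alternating_form_def)
  have "jform x y = jform y (x::bit^4)" for x y
    by (simp add: jform_def algebra_simps)
  then have "vec.span {x, y} \<subseteq> form_perp jform (vec.span {x, y}) \<longleftrightarrow> jform x y = 0" for x y :: "bit ^ 4"
    unfolding bit_span_pair form_perp_def
    by (auto simp: jform_add_left jform_add_right alt) (simp_all add: jform_def)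
  then show ?thesis
    unfolding isotropic_lines_def bit_lines_iff by blast
qed

lemma frame_lines_eq:
  "frame_lines = {vec.span {bvec frame_matrix x, bvec frame_matrix y} | x y.
     x \<noteq> 0 \<and> y \<noteq> 0 \<and> x \<noteq> y \<and> jform x y = 0}"
proof -
  have "baer_map frame_matrix (vec.span {x, y}) = vec.span {bvec frame_matrix x, bvec frame_matrix y}" for x y
    unfolding baer_map_span by simp
  then show ?thesis
    unfolding frame_lines_def isotropic_lines_jform by (auto simp: image_iff) metis+
qed

context
  fixes \<pi> :: "('k ^ 4) set \<Rightarrow> ('k ^ 4) set"
  assumes \<pi>: "\<And>U. vec.subspace U \<Longrightarrow> \<pi> U = form_perp h U"
begin

lemma span_isotropic:
  assumes "\<And>u v. u \<in> X \<Longrightarrow> v \<in> X \<Longrightarrow> h u v = 0"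
  shows "vec.span X \<subseteq> \<pi> (vec.span X)"
  using h_span_zero[OF assms] by (auto simp: \<pi> form_perp_def)

lemma frame_subquadrangle: "symplectic_subquadrangle \<pi> (baer_points frame_matrix, frame_lines)"
proof -
  have jself: "jform x x = (0::bit)" for x
    using alternating_jform[where 'a=bit] by (simp add: alternating_form_def)
  have jcomm: "jform x y = jform y (x::bit^4)" for x y
    by (simp add: jform_def algebra_simps)
  note inv = invertible_frame_matrix
  have points: "baer_points frame_matrix \<subseteq> isotropic_points \<pi>"
  proof
    fix P assume "P \<in> baer_points frame_matrix"
    then obtain x where "x \<noteq> 0" "P = vec.span {bvec frame_matrix x}"
      by (auto simp: baer_points_eq)
    then show "P \<in> isotropic_points \<pi>"
      using span_isotropic[of "{bvec frame_matrix x}"] bvec_eq_0_iff[OF inv]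
      unfolding isotropic_points_def proj_points_iff by (auto simp: h_bvec jself)
  qed
  have lines: "frame_lines \<subseteq> isotropic_lines \<pi>"
  proof
    fix l assume "l \<in> frame_lines"
    then obtain x y where xy: "x \<noteq> 0" "y \<noteq> 0" "x \<noteq> y" "jform x y = 0"
      and l: "l = vec.span {bvec frame_matrix x, bvec frame_matrix y}"
      unfolding frame_lines_eq by blast
    have "l \<subseteq> \<pi> l"
      unfolding l using xy(4) by (intro span_isotropic) (auto simp: h_bvec jself jcomm[of y x])
    moreover have "l \<in> proj_lines"
      unfolding proj_lines_iff l using bvec_independent[OF inv xy(1-3)] bvec_eq_iff[OF inv] xy(3) by blast
    ultimately show "l \<in> isotropic_lines \<pi>"
      by (simp add: isotropic_lines_def)
  qed
  have sym: "symplectic_polarity (form_perp (jform :: bit ^ 4 \<Rightarrow> _))" "symplectic_polarity (form_perp symplectic)"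
    unfolding symplectic_polarity_def
    using alternating_jform[OF bit_add_self] nondegenerate_jform[OF bit_add_self]
      alternating_symp nondegenerate_symp
    by blast+
  have "extends_polarity frame_matrix (form_perp jform) (form_perp symplectic)"
    unfolding extends_polarity_def using perp_baer_map by blast
  moreover have "form_perp symplectic (\<pi> U) = conjugation ` U \<and> \<pi> (form_perp symplectic U) = conjugation ` U"
    if "vec.subspace U" for U
    using that by (simp add: \<pi> subspace_perp h_perp perp_conjugation symplectic_double_perp)
  ultimately show ?thesis
    unfolding symplectic_subquadrangle_def isotropic_geometry_def
    using points lines sym inv semilinear_involution_conjugation conjugation_fixed_points
    by (auto simp: frame_lines_def)
qed

lemma frame_ovoid:
  "elliptic_ovoid (baer_points frame_matrix, frame_lines) (ovoid_of {a, b, c, d, a + b + c + d})"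
proof -
  interpret elliptic_form base_quadric by (rule elliptic_base)
  note inv = invertible_frame_matrix
  have Z: "Z = {axis 1 1, axis 2 1, axis 3 1, axis 4 1, 1}"
    unfolding Z_def base_quadric_singular by blast
  have B: "B = jform"
    by (intro ext) (simp add: B_def base_quadric_add ac_simps)
  have E: "ovoid_of {a, b, c, d, a + b + c + d} = (\<lambda>x. vec.span {bvec frame_matrix x}) ` Z"
    unfolding Z ovoid_of_def by (simp add: bvec_frame)
  have "(\<lambda>x. vec.span {bvec frame_matrix x}) ` Z = baer_map frame_matrix ` quadric base_quadric"
    unfolding quadric_eq image_image baer_map_span by simp
  moreover have "elliptic_quadric (quadric base_quadric)"
    unfolding elliptic_quadric_def using form nonempty no_line by blast
  moreover have "frame_lines = {l \<in> baer_lines frame_matrix.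
      card {P \<in> (\<lambda>x. vec.span {bvec frame_matrix x}) ` Z. P \<subseteq> l} = 1}"
  proof -
    have "card {P \<in> (\<lambda>x. vec.span {bvec frame_matrix x}) ` Z. P \<subseteq> vec.span {bvec frame_matrix x, bvec frame_matrix y}} = 1
      \<longleftrightarrow> jform x y = 0" if "x \<noteq> 0" "y \<noteq> 0" "x \<noteq> y" for x y
    proof -
      have "{r \<in> {x, y, x + y}. r \<in> Z} = {r \<in> {x, y, x + y}. base_quadric r = 0}"
        using that by (auto simp: Z_def)
      moreover have "0 \<notin> Z"
        by (simp add: Z_def)
      ultimately show ?thesis
        using card_ovoid_on_line[OF inv that, of Z] tangent_iff[OF that] by (simp add: B)
    qed
    then show ?thesis
      unfolding frame_lines_eq by (intro set_eqI) (auto simp only: baer_lines_iff mem_Collect_eq)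
  qed
  ultimately show ?thesis
    unfolding elliptic_ovoid_def E using inv by fastforce
qed

end

end

context hermitian_space4
begin

context
  fixes \<pi> :: "('k ^ 4) set \<Rightarrow> ('k ^ 4) set"
  assumes \<pi>: "\<And>U. vec.subspace U \<Longrightarrow> \<pi> U = form_perp h U"
begin

lemma pentad_subquadrangle:
  assumes "pentad S"
  shows "\<exists>W. symplectic_subquadrangle \<pi> W \<and> elliptic_ovoid W (ovoid_of S)"
proof -
  obtain a b c d where "frame4 h a b c d" and S: "S = {a, b, c, d, a + b + c + d}"
    using pentad_frame[OF assms] by metis
  then interpret frame4 h a b c d by simp
  show ?thesis
    unfolding S using frame_subquadrangle[OF \<pi>] frame_ovoid by blast
qed

lemma ovoid_vertices_eq: "ovoid_vertices \<pi> = ovoid_of ` {S. pentad S}"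
  unfolding ovoid_vertices_def using pentad_of_ovoid[OF \<pi>] pentad_subquadrangle by blast

lemma fst_subquadrangle_of:
  assumes "pentad S"
  shows "fst (subquadrangle_of \<pi> (ovoid_of S)) = quadrangle_points_of S"
proof -
  have char: "fst W = quadrangle_points_of S \<and> snd W = tangents (quadrangle_points_of S) (ovoid_of S)"
    if W: "symplectic_subquadrangle \<pi> W \<and> elliptic_ovoid W (ovoid_of S)" for W
  proof -
    obtain T where "pentad T" "ovoid_of S = ovoid_of T" "fst W = quadrangle_points_of T"
      "snd W = tangents (fst W) (ovoid_of S)"
      using pentad_of_ovoid[OF \<pi>, of W "ovoid_of S"] W by blast
    then show ?thesis
      using quadrangle_points_of_unique[OF assms, of T] by simp
  qed
  obtain W where W: "symplectic_subquadrangle \<pi> W \<and> elliptic_ovoid W (ovoid_of S)"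
    using pentad_subquadrangle[OF assms] by blast
  have "subquadrangle_of \<pi> (ovoid_of S) = W"
    unfolding subquadrangle_of_def
  proof (rule the_equality)
    fix V assume "symplectic_subquadrangle \<pi> V \<and> elliptic_ovoid V (ovoid_of S)"
    then show "V = W"
      using char[OF W] char[of V] by (simp add: prod_eq_iff)
  qed (rule W)
  then show ?thesis
    using char[OF W] by simp
qed

end
end

subsection \<open>Counting maximal cliques\<close>

lemma maximal_triangles_through:
  assumes sym: "\<And>x y. adj x y \<Longrightarrow> adj y x" and irrefl: "\<not> adj v v" and v: "v \<in> V"
    and N: "N = {u \<in> V. adj v u}"
    and no_4_clique: "\<And>S. S \<subseteq> N \<Longrightarrow> card S = 3 \<Longrightarrow> \<not> pairwise adj S"
  shows "card {T. card T = 3 \<and> maximal_clique V adj T \<and> P T \<and> v \<in> T} =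
    card {S. S \<subseteq> N \<and> card S = 2 \<and> pairwise adj S \<and> P (insert v S)}"
proof -
  let ?A = "{S. S \<subseteq> N \<and> card S = 2 \<and> pairwise adj S \<and> P (insert v S)}"
  have vN: "v \<notin> N"
    using irrefl by (simp add: N)
  have "{T. card T = 3 \<and> maximal_clique V adj T \<and> P T \<and> v \<in> T} = insert v ` ?A"
  proof (intro equalityI subsetI)
    fix T assume "T \<in> {T. card T = 3 \<and> maximal_clique V adj T \<and> P T \<and> v \<in> T}"
    then have T: "card T = 3" "T \<subseteq> V" "pairwise adj T" "P T" "v \<in> T"
      by (auto simp: maximal_clique_def clique_def)
    have "T - {v} \<subseteq> N"
      using T by (auto simp: N pairwise_def)
    moreover have "card (T - {v}) = 2"
      using T by simp
    moreover have "pairwise adj (T - {v})"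
      using T(3) by (simp add: pairwise_def)
    ultimately show "T \<in> insert v ` ?A"
      using T(4,5) by (intro image_eqI[of _ _ "T - {v}"]) (auto simp: insert_absorb)
  next
    fix T assume "T \<in> insert v ` ?A"
    then obtain S where S: "T = insert v S" "S \<subseteq> N" "card S = 2" "pairwise adj S" "P T"
      by auto
    have fin: "finite S"
      using S(3) by (simp add: card_ge_0_finite)
    have "card T = 3"
      using S vN fin by (auto simp: card_insert_if)
    moreover have "clique V adj T"
      using S v sym by (auto simp: clique_def N pairwise_insert)
    moreover have False if D: "clique V adj D" "T \<subset> D" for D
    proof -
      obtain x where x: "x \<in> D" "x \<notin> T"
        using D(2) by blast
      have D': "D \<subseteq> V" "pairwise adj D"
        using D(1) by (auto simp: clique_def)
      have "v \<in> D" "S \<subseteq> D"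
        using D(2) S(1) by auto
      have "x \<in> N"
        using x D' \<open>v \<in> D\<close> S(1) by (auto simp: N pairwise_def)
      then have "insert x S \<subseteq> N"
        using S(2) by simp
      moreover have "card (insert x S) = 3"
        using x S fin by simp
      moreover have "pairwise adj (insert x S)"
        using D'(2) x(1) \<open>S \<subseteq> D\<close> by (meson insert_subset pairwise_subset)
      ultimately show False
        using no_4_clique by blast
    qed
    ultimately show "T \<in> {T. card T = 3 \<and> maximal_clique V adj T \<and> P T \<and> v \<in> T}"
      using S by (auto simp: maximal_clique_def)
  qed
  moreover have "inj_on (insert v) ?A"
    using vN by (intro inj_onI) (metis (no_types, lifting) insert_ident mem_Collect_eq subsetD)
  ultimately show ?thesis
    by (simp add: card_image)
qed

lemma maximal_triangles_eq:
  "maximal_triangles \<pi> n = {T. card T = 3 \<and> maximal_clique (ovoid_vertices \<pi>) (ovoid_adjacent \<pi>) T \<and>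
     card (\<Inter>E\<in>T. fst (subquadrangle_of \<pi> E)) = n}"
  (is "_ = ?R")
proof (intro equalityI subsetI)
  have inter: "(\<Inter>E\<in>{E, E', E''}. fst (subquadrangle_of \<pi> E)) =
      fst (subquadrangle_of \<pi> E) \<inter> fst (subquadrangle_of \<pi> E') \<inter> fst (subquadrangle_of \<pi> E'')" for E E' E''
    by auto
  {
    fix T assume "T \<in> maximal_triangles \<pi> n"
    then obtain E E' E'' where "T = {E, E', E''}" "E \<noteq> E'" "E \<noteq> E''" "E' \<noteq> E''"
      "maximal_clique (ovoid_vertices \<pi>) (ovoid_adjacent \<pi>) T"
      "card (\<Inter>E\<in>T. fst (subquadrangle_of \<pi> E)) = n"
      unfolding maximal_triangles_def inter[symmetric] by blast
    then show "T \<in> ?R"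
      by simp
  next
    fix T assume T: "T \<in> ?R"
    then obtain E E' E'' where "T = {E, E', E''}" "E \<noteq> E'" "E \<noteq> E''" "E' \<noteq> E''"
      unfolding mem_Collect_eq card_3_iff by blast
    then show "T \<in> maximal_triangles \<pi> n"
      unfolding maximal_triangles_def inter[symmetric] using T by blast
  }
qed

lemma ovoid_adjacent_sym: "ovoid_adjacent \<pi> x y \<Longrightarrow> ovoid_adjacent \<pi> y x"
  by (simp add: ovoid_adjacent_def Int_commute)

lemma fold_Int: "fold (\<lambda>a. (\<inter>) (f a)) t X = X \<inter> (\<Inter>a\<in>set t. f a)"
  by (induction t arbitrary: X) auto

lemma symp_model_adjacent: "symp model_adjacent"
  by (rule sympI) (simp add: model_adjacent_def Int_commute)

lemma base_pentad: "distinct base_pentad" "pentad4 (set base_pentad)"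
  by (simp_all add: base_pentad_def pentad4_def)

lemma base_not_adjacent: "\<not> model_adjacent (model_vertex base_pentad) (model_vertex base_pentad)"
  by code_simp

lemma inj_on_fst_model_vertices: "inj_on fst (set model_vertices)"
  and distinct_base_neighbours: "distinct base_neighbours"
  using distinct_model_vertices by (simp_all add: distinct_map base_neighbours_def)

lemma pentads4_points4:
  "l \<in> set (pentads4 points4) \<Longrightarrow> pentad4 (set l) \<and> distinct l"
  using pentads4_sound[of points4 l] distinct_points4 by (simp add: set_points4)

context frame4
begin

definition vertex :: "vec4 set \<times> vec4 set \<Rightarrow> ('k ^ 4) set set" where
  "vertex A = point ` fst A"

definition models :: "(vec4 set \<times> vec4 set) set" where
  "models = model_vertex ` {l. distinct l \<and> pentad4 (set l)}"

lemma model_vertices_subset: "set model_vertices \<subseteq> models"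
  using pentads4_points4 by (auto simp: model_vertices_def models_def)

lemma models_normal:
  "A \<in> models \<Longrightarrow> fst A \<subseteq> {x. x \<noteq> zero_vec4 \<and> normal4 x = x} \<and> snd A \<subseteq> {x. x \<noteq> zero_vec4 \<and> normal4 x = x}"
  unfolding models_def using model_vertex_normal by fastforce

lemma card_point_image: "X \<subseteq> {x. x \<noteq> zero_vec4 \<and> normal4 x = x} \<Longrightarrow> card (point ` X) = card X"
  by (rule card_image[OF inj_on_subset[OF inj_on_point]])

lemma point_image_Int:
  assumes "X \<subseteq> {x. x \<noteq> zero_vec4 \<and> normal4 x = x}" "Y \<subseteq> {x. x \<noteq> zero_vec4 \<and> normal4 x = x}"
  shows "point ` X \<inter> point ` Y = point ` (X \<inter> Y)"
  by (rule inj_on_image_Int[OF inj_on_point assms, symmetric])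

context
  fixes \<pi> :: "('k ^ 4) set \<Rightarrow> ('k ^ 4) set"
  assumes \<pi>: "\<And>U. vec.subspace U \<Longrightarrow> \<pi> U = form_perp h U"
begin

lemma models_subquadrangle:
  assumes "A \<in> models"
  shows "fst (subquadrangle_of \<pi> (vertex A)) = point ` snd A"
proof -
  obtain l where l: "A = model_vertex l" "distinct l" "pentad4 (set l)"
    using assms by (auto simp: models_def)
  then have "pentad (comb ` set l)"
    by (simp add: pentad_comb_iff)
  then show ?thesis
    using fst_subquadrangle_of[OF \<pi>] l
    by (simp add: vertex_def flip: ovoid_of_comb quadrangle_points_of_comb)
qed

lemma ovoid_adjacent_vertex_iff:
  assumes "A \<in> models" "A' \<in> models"
  shows "ovoid_adjacent \<pi> (vertex A) (vertex A') \<longleftrightarrow> model_adjacent A A'"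
  unfolding ovoid_adjacent_def models_subquadrangle[OF assms(1)] models_subquadrangle[OF assms(2)]
  unfolding model_adjacent_def vertex_def
  using models_normal[OF assms(1)] models_normal[OF assms(2)]
  by (simp add: point_image_Int card_point_image le_infI1)

lemma ovoid_vertices_model: "ovoid_vertices \<pi> = vertex ` set model_vertices"
proof (intro equalityI subsetI)
  fix E assume "E \<in> ovoid_vertices \<pi>"
  then obtain S where "pentad S" "E = ovoid_of S"
    using ovoid_vertices_eq[OF \<pi>] by auto
  then obtain S' where S': "pentad4 S'" "E = ovoid_of (comb ` S')"
    using pentad_imp_comb by blast
  have nz: "u \<noteq> zero_vec4" if u: "u \<in> S'" for u
  proof -
    obtain v where "v \<in> S'" "v \<noteq> u"
      using card_5_other[of S' u] S'(1) by (auto simp: pentad4_def)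
    then have "herm4 u v = F1"
      using S'(1) u by (auto simp: pentad4_def)
    then show ?thesis by auto
  qed
  have "normal4 ` S' \<subseteq> set points4"
    using S'(1) nz by (auto simp: set_points4 isotropic_normal4 pentad4_def)
  then obtain l where l: "l \<in> set (pentads4 points4)" "normal4 ` set l = normal4 ` S'"
    using pentads4_complete[of points4 S'] S'(1) distinct_points4 by (auto simp: set_points4)
  have "E = point ` S'"
    by (simp add: S'(2) ovoid_of_def image_image flip: point_def)
  also have "\<dots> = point ` normal4 ` S'"
    by (simp add: image_image)
  finally have "E = vertex (model_vertex l)"
    by (simp only: vertex_def model_vertex_def fst_conv l(2))
  then show "E \<in> vertex ` set model_vertices"
    using l(1) by (auto simp: model_vertices_def)
next
  fix E assume "E \<in> vertex ` set model_vertices"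
  then obtain l where "l \<in> set (pentads4 points4)" "E = vertex (model_vertex l)"
    unfolding model_vertices_def by auto
  then have l: "pentad4 (set l)" "distinct l" "E = vertex (model_vertex l)"
    using pentads4_points4 by auto
  then have "E = ovoid_of (comb ` set l)"
    by (simp add: vertex_def ovoid_of_comb)
  then show "E \<in> ovoid_vertices \<pi>"
    using l(1) ovoid_vertices_eq[OF \<pi>] pentad_comb_iff by blast
qed

lemma inj_on_vertex: "inj_on vertex (set model_vertices)"
proof (rule inj_onI)
  fix A A' assume A: "A \<in> set model_vertices" "A' \<in> set model_vertices" "vertex A = vertex A'"
  then have "fst A = fst A'"
    using models_normal model_vertices_subset unfolding vertex_def
    by (metis (no_types, lifting) inj_on_image_eq_iff inj_on_point subsetD)
  then show "A = A'"
    using A(1,2) inj_on_fst_model_vertices by (simp add: inj_on_eq_iff)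
qed

lemma card_ovoid_vertices: "card (ovoid_vertices \<pi>) = 216"
proof -
  have "distinct model_vertices"
    using distinct_model_vertices by (simp add: distinct_map)
  then show ?thesis
    unfolding ovoid_vertices_model card_image[OF inj_on_vertex]
    by (simp add: distinct_card length_model_vertices)
qed

lemma card_maximal_triangles_through_base:
  assumes v: "v = ovoid_of {a, b, c, d, a + b + c + d}"
  shows "card {T \<in> maximal_triangles \<pi> n. v \<in> T} = length (base_triangles n)"
proof -
  let ?e = "model_vertex base_pentad" and ?adj = "ovoid_adjacent \<pi>"
  let ?w = "\<lambda>E. fst (subquadrangle_of \<pi> E)"
  let ?P = "\<lambda>T. card (\<Inter>E\<in>T. ?w E) = n"
  have e: "?e \<in> models"
    using base_pentad by (simp add: models_def)
  have "comb ` set base_pentad = {a, b, c, d, a + b + c + d}"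
    by (simp add: base_pentad_def)
  then have ve: "v = vertex ?e"
    unfolding v vertex_def using ovoid_of_comb[OF base_pentad] by simp
  have "pentad {a, b, c, d, a + b + c + d}"
    using base_pentad(2) pentad_comb_iff[of "set base_pentad"]
    by (simp only: \<open>comb ` set base_pentad = _\<close>)
  then have vV: "v \<in> ovoid_vertices \<pi>"
    unfolding v using ovoid_vertices_eq[OF \<pi>] by auto
  have not_adj: "\<not> ?adj v v"
    unfolding ve using ovoid_adjacent_vertex_iff[OF e e] base_not_adjacent by simp
  have nb: "set base_neighbours \<subseteq> models" "set base_neighbours \<subseteq> set model_vertices"
    using model_vertices_subset by (auto simp: base_neighbours_def)
  define N where "N = {u \<in> ovoid_vertices \<pi>. ?adj v u}"
  have N: "N = vertex ` set base_neighbours"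
    unfolding N_def ovoid_vertices_model base_neighbours_def ve
    using ovoid_adjacent_vertex_iff[OF e] model_vertices_subset by auto
  have inj: "inj_on vertex (set base_neighbours)"
    using inj_on_subset[OF inj_on_vertex nb(2)] .
  have pw: "pairwise ?adj (vertex ` S) \<longleftrightarrow> pairwise model_adjacent S" if S: "S \<subseteq> set base_neighbours" for S
  proof -
    have "(vertex x = vertex y \<longleftrightarrow> x = y) \<and> (?adj (vertex x) (vertex y) \<longleftrightarrow> model_adjacent x y)"
      if xy: "x \<in> S" "y \<in> S" for x y
    proof -
      have "x \<in> set base_neighbours" "y \<in> set base_neighbours"
        using xy S by blast+
      then show ?thesis
        using inj_on_eq_iff[OF inj] ovoid_adjacent_vertex_iff nb(1) by blast
    qed
    then show ?thesis
      unfolding pairwise_image pairwise_def by auto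
  qed
  have cliques: "set ` set (cliques model_adjacent k base_neighbours) =
      {S. S \<subseteq> set base_neighbours \<and> card S = k \<and> pairwise model_adjacent S}" for k
    by (rule set_cliques[OF distinct_base_neighbours symp_model_adjacent])
  have "\<not> pairwise ?adj S" if S: "S \<subseteq> N" "card S = 3" for S
  proof
    assume adj: "pairwise ?adj S"
    obtain S' where S': "S' \<subseteq> set base_neighbours" "S = vertex ` S'"
      using S(1) unfolding N by (meson subset_imageE)
    then have "card S' = 3"
      using S(2) inj by (metis card_image inj_on_subset)
    then have "S' \<in> set ` set (cliques model_adjacent 3 base_neighbours)"
      using cliques pw[OF S'(1)] adj S' by blast
    then show False
      by (simp add: no_base_4_cliques)
  qed
  then have "card {T. card T = 3 \<and> maximal_clique (ovoid_vertices \<pi>) ?adj T \<and> ?P T \<and> v \<in> T} =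
      card {S. S \<subseteq> N \<and> card S = 2 \<and> pairwise ?adj S \<and> ?P (insert v S)}"
    using ovoid_adjacent_sym not_adj by (intro maximal_triangles_through vV N_def) blast+
  also have "{S. S \<subseteq> N \<and> card S = 2 \<and> pairwise ?adj S \<and> ?P (insert v S)} =
      (\<lambda>t. vertex ` set t) ` set (base_triangles n)"
  proof -
    have P: "?P (insert v (vertex ` set t)) \<longleftrightarrow>
        card (fold (\<lambda>a. (\<inter>) (snd a)) t (snd ?e)) = n" if "set t \<subseteq> set base_neighbours" for t
    proof -
      have nrm: "snd A \<subseteq> {x. x \<noteq> zero_vec4 \<and> normal4 x = x}" if "A \<in> insert ?e (set t)" for A
        using that \<open>set t \<subseteq> _\<close> nb(1) e models_normal by blast
      have "(\<Inter>E\<in>insert v (vertex ` set t). ?w E) = (\<Inter>A\<in>insert ?e (set t). ?w (vertex A))"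
        by (simp add: ve)
      also have "\<dots> = (\<Inter>A\<in>insert ?e (set t). point ` snd A)"
        using e nb(1) that by (intro INF_cong refl models_subquadrangle) blast
      also have "\<dots> = point ` (\<Inter>A\<in>insert ?e (set t). snd A)"
        using image_INT[OF inj_on_point, of "insert ?e (set t)" snd ?e] nrm by blast
      finally show ?thesis
        using nrm[of ?e] by (simp add: fold_Int card_point_image le_infI1)
    qed
    have "S \<subseteq> N \<and> card S = 2 \<and> pairwise ?adj S \<and> ?P (insert v S) \<longleftrightarrow>
        S \<in> (\<lambda>t. vertex ` set t) ` set (base_triangles n)" for S
    proof
      assume S: "S \<subseteq> N \<and> card S = 2 \<and> pairwise ?adj S \<and> ?P (insert v S)"
      then obtain S' where S': "S' \<subseteq> set base_neighbours" "S = vertex ` S'"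
        unfolding N by (meson subset_imageE)
      then have "card S' = 2"
        using S inj by (metis card_image inj_on_subset)
      then have "S' \<in> set ` set (cliques model_adjacent 2 base_neighbours)"
        using cliques pw[OF S'(1)] S S' by blast
      then obtain t where "t \<in> set (cliques model_adjacent 2 base_neighbours)" "S' = set t"
        by blast
      then show "S \<in> (\<lambda>t. vertex ` set t) ` set (base_triangles n)"
        using S S' P[of t] by (auto simp: base_triangles_def)
    next
      assume "S \<in> (\<lambda>t. vertex ` set t) ` set (base_triangles n)"
      then obtain t where t: "t \<in> set (cliques model_adjacent 2 base_neighbours)" "S = vertex ` set t"
        and n: "card (fold (\<lambda>a. (\<inter>) (snd a)) t (snd ?e)) = n"
        by (auto simp: base_triangles_def)
      then have t': "set t \<subseteq> set base_neighbours" "card (set t) = 2" "pairwise model_adjacent (set t)"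
        using cliques[of 2] by auto
      have "card S = 2"
        using t' t(2) inj by (metis card_image inj_on_subset)
      then show "S \<subseteq> N \<and> card S = 2 \<and> pairwise ?adj S \<and> ?P (insert v S)"
        using t' t(2) n P[OF t'(1)] pw[OF t'(1)] N by auto
    qed
    then show ?thesis by blast
  qed
  also have "card \<dots> = length (base_triangles n)"
  proof -
    have d: "distinct (map set (base_triangles n))"
      unfolding base_triangles_def
      by (rule distinct_map_filter[OF distinct_cliques[OF distinct_base_neighbours]])
    have sub: "set t \<subseteq> set base_neighbours" if "t \<in> set (base_triangles n)" for t
      using that cliques[of 2] by (auto simp: base_triangles_def)
    have "inj_on (\<lambda>t. vertex ` set t) (set (base_triangles n))"
      using d sub inj by (intro inj_onI) (metis distinct_map inj_on_eq_iff inj_on_image_eq_iff)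
    then show ?thesis
      using d by (simp add: card_image distinct_card distinct_map)
  qed
  finally show ?thesis
    by (simp add: maximal_triangles_eq conj_assoc)
qed

end

end

theorem proposition4p2:
  fixes \<pi> :: "('k::{field,finite} ^ 4) set \<Rightarrow> ('k ^ 4) set"
  assumes "CARD('k) = 4"
    and "unitary_polarity4 \<pi>"
  shows "card (maximal_triangles \<pi> 6) = 1440 \<and> card (maximal_triangles \<pi> 2) = 4320"
proof -
  obtain h where h: "hermitian_form4 h" "nondegenerate_form h"
    and \<pi>: "\<And>U. vec.subspace U \<Longrightarrow> \<pi> U = form_perp h U"
    using assms(2) unfolding unitary_polarity4_def by blast
  interpret hermitian_space4 h
    by unfold_locales (use assms(1) h in auto)
  have card_V: "card (ovoid_vertices \<pi>) = 216"
    using ex_frame frame4.card_ovoid_vertices[OF _ \<pi>] by blast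
  have through: "card {T \<in> maximal_triangles \<pi> n. v \<in> T} = length (base_triangles n)"
    if v: "v \<in> ovoid_vertices \<pi>" for v n
  proof -
    obtain S where S: "pentad S" "v = ovoid_of S"
      using v ovoid_vertices_eq[OF \<pi>] by blast
    obtain a b c d where "frame4 h a b c d" "S = {a, b, c, d, a + b + c + d}"
      using pentad_frame[OF S(1)] by metis
    then show ?thesis
      using frame4.card_maximal_triangles_through_base[OF _ \<pi>] S(2) by blast
  qed
  have "216 * length (base_triangles n) = 3 * card (maximal_triangles \<pi> n)" for n
  proof -
    have "card {v \<in> ovoid_vertices \<pi>. v \<in> T} = 3" if "T \<in> maximal_triangles \<pi> n" for T
    proof -
      have "card T = 3" "T \<subseteq> ovoid_vertices \<pi>"
        using that by (auto simp: maximal_triangles_eq maximal_clique_def clique_def)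
      moreover from this have "{v \<in> ovoid_vertices \<pi>. v \<in> T} = T"
        by blast
      ultimately show ?thesis by simp
    qed
    then have "(\<Sum>v\<in>ovoid_vertices \<pi>. card {T \<in> maximal_triangles \<pi> n. v \<in> T}) =
        3 * card (maximal_triangles \<pi> n)"
      by (intro sum_multicount) auto
    then show ?thesis
      using through[of _ n] by (simp add: card_V)
  qed
  from this[of 6] this[of 2] show ?thesis
    using length_base_triangles by simp
qed

end
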